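(* Let $k\ge 3$ be an integer and let $\gamma\subset\mathbb{R}^2$ be a $C^2$-smooth, planar, strictly convex closed curve which is invariant under a linear map of $\mathbb{R}^2$ of order $k$. If the Outer billiard map in the exterior of $\gamma$ has a rotational invariant curve of $k$-periodic orbits, then $\gamma$ is an ellipse.
   Context: A linear map $A$ has order $k$ if $k$ is the least positive integer with $A^k=I$. Outer billiard map: let $\gamma(t)$ be a regular, positively oriented parametrization. Each point $x$ in the exterior of $\gamma$ can be uniquely written as $x=\gamma(t)+\lambda\dot\gamma(t)=\gamma(t_1)-\lambda_1\dot\gamma(t_1)$ with $\lambda,\lambda_1>0$. Using $(t,\lambda)$ as coordinates, the exterior of $\gamma$ is an (infinite) cylinder, and the Outer billiard map is $T(t,\lambda)=(t_1,\lambda_1)$; geometrically, $x$ is reflected through the right (as seen from $x$) tangency point $\gamma(t_1)$. It is a twist map. A rotational invariant curve is a simple closed curve in the phase cylinder, homotopically non-trivial (winding once around the cylinder), that is mapped to itself by $T$. It is a rotational invariant curve of $k$-periodic orbits if all its points are periodic for $T$ with (minimal) period $k$; its rotation number is then of the form $r/k$ with $r$ coprime to $k$. *)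

theory Defs
  imports "HOL-Complex_Analysis.Complex_Analysis"
begin

text \<open>
  The plane is the real inner product space \<^typ>\<open>complex\<close>; \<^const>\<open>linear\<close> means real-linear.
  A closed curve is given by an \<open>L\<close>-periodic map \<open>\<gamma> :: real \<Rightarrow> complex\<close>, and as a point set
  it is \<open>range \<gamma>\<close>.
\<close>

abbreviation velocity :: "(real \<Rightarrow> complex) \<Rightarrow> real \<Rightarrow> complex" where
  "velocity \<gamma> t \<equiv> vector_derivative \<gamma> (at t)"

definition C2_smooth :: "(real \<Rightarrow> complex) \<Rightarrow> bool" where
  "C2_smooth \<gamma> \<longleftrightarrow> \<gamma> C1_differentiable_on UNIV \<and> velocity \<gamma> C1_differentiable_on UNIV"

definition regular_closed_curve :: "real \<Rightarrow> (real \<Rightarrow> complex) \<Rightarrow> bool" where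
  "regular_closed_curve L \<gamma> \<longleftrightarrow>
     0 < L \<and> (\<forall>t. \<gamma> (t + L) = \<gamma> t) \<and> inj_on \<gamma> {0..<L} \<and>
     (\<forall>t. velocity \<gamma> t \<noteq> 0)"

definition positively_oriented :: "real \<Rightarrow> (real \<Rightarrow> complex) \<Rightarrow> bool" where
  "positively_oriented L \<gamma> \<longleftrightarrow>
     (\<forall>z \<in> inside (range \<gamma>). winding_number (\<lambda>s. \<gamma> (L * s)) z = 1)"

text \<open>
  Strict convexity of a curve is that of the closed region it bounds; no condition is
  imposed on the curvature, which may vanish at points of the curve.
\<close>

definition strictly_convex_set :: "complex set \<Rightarrow> bool" where
  "strictly_convex_set K \<longleftrightarrow>
     (\<forall>x\<in>K. \<forall>y\<in>K. x \<noteq> y \<longrightarrow> open_segment x y \<subseteq> interior K)"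

definition strictly_convex_curve :: "(real \<Rightarrow> complex) \<Rightarrow> bool" where
  "strictly_convex_curve \<gamma> \<longleftrightarrow> strictly_convex_set (range \<gamma> \<union> inside (range \<gamma>))"

definition map_order :: "('a \<Rightarrow> 'a) \<Rightarrow> nat \<Rightarrow> bool" where
  "map_order A k \<longleftrightarrow> 0 < k \<and> A ^^ k = id \<and> (\<forall>j. 0 < j \<and> j < k \<longrightarrow> A ^^ j \<noteq> id)"

definition minimal_period :: "('a \<Rightarrow> 'a) \<Rightarrow> nat \<Rightarrow> 'a \<Rightarrow> bool" where
  "minimal_period T k x \<longleftrightarrow>
     0 < k \<and> (T ^^ k) x = x \<and> (\<forall>j. 0 < j \<and> j < k \<longrightarrow> (T ^^ j) x \<noteq> x)"

abbreviation exterior :: "(real \<Rightarrow> complex) \<Rightarrow> complex set" where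
  "exterior \<gamma> \<equiv> outside (range \<gamma>)"

text \<open>
  A pair \<open>(t, \<lambda>)\<close> of cylinder coordinates, with \<open>t\<close> taken modulo \<open>L\<close> and \<open>\<lambda> > 0\<close>, stands
  for the exterior point \<open>\<gamma> t + \<lambda> \<gamma>' t\<close>; under this homeomorphism the exterior is the
  phase cylinder. If \<open>x = \<gamma> t\<^sub>1 - \<mu> \<gamma>' t\<^sub>1\<close>, then the image of \<open>x\<close> is the point with
  coordinates \<open>(t\<^sub>1, \<mu>)\<close>, that is, the reflection of \<open>x\<close> in the tangency point \<open>\<gamma> t\<^sub>1\<close>.
  The value is meaningful only for \<open>x\<close> in the exterior of a positively oriented, strictly
  convex curve, where \<open>\<gamma> t\<^sub>1\<close> and \<open>\<mu>\<close> are unique.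
\<close>

definition outer_billiard :: "(real \<Rightarrow> complex) \<Rightarrow> complex \<Rightarrow> complex" where
  "outer_billiard \<gamma> x =
     (THE y. \<exists>t\<^sub>1 \<mu>. 0 < \<mu> \<and> x = \<gamma> t\<^sub>1 - \<mu> *\<^sub>R velocity \<gamma> t\<^sub>1 \<and>
                       y = \<gamma> t\<^sub>1 + \<mu> *\<^sub>R velocity \<gamma> t\<^sub>1)"

text \<open>
  For a simple loop in the exterior, being homotopically non-trivial is the same as winding
  exactly once (in either direction) around the cylinder.
\<close>

definition rotational_invariant_curve ::
  "(real \<Rightarrow> complex) \<Rightarrow> (real \<Rightarrow> complex) \<Rightarrow> bool" where
  "rotational_invariant_curve \<gamma> c \<longleftrightarrow>
     simple_path c \<and> pathfinish c = pathstart c \<and> path_image c \<subseteq> exterior \<gamma> \<and>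
     (\<forall>a. \<not> homotopic_loops (exterior \<gamma>) c (linepath a a)) \<and>
     outer_billiard \<gamma> ` path_image c = path_image c"

definition rotational_invariant_curve_of_periodic_orbits ::
  "(real \<Rightarrow> complex) \<Rightarrow> nat \<Rightarrow> (real \<Rightarrow> complex) \<Rightarrow> bool" where
  "rotational_invariant_curve_of_periodic_orbits \<gamma> k c \<longleftrightarrow>
     rotational_invariant_curve \<gamma> c \<and>
     (\<forall>x \<in> path_image c. minimal_period (outer_billiard \<gamma>) k x)"

text \<open>
  The rigid motion \<open>w \<mapsto> p + u w\<close> carries the standard ellipse with semi-axes \<open>a\<close>, \<open>b\<close>
  to \<open>E\<close>; circles are included.
\<close>

definition is_ellipse :: "complex set \<Rightarrow> bool" where
  "is_ellipse E \<longleftrightarrow>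
     (\<exists>p u a b. cmod u = 1 \<and> 0 < a \<and> 0 < b \<and>
        E = (\<lambda>w. p + u * w) ` {w. (Re w / a)\<^sup>2 + (Im w / b)\<^sup>2 = 1})"

end

theory Submission
  imports Defs
begin

text \<open>
  Let \<open>T\<close> be the outer billiard map, \<open>A\<close> the given linear symmetry of order \<open>k\<close>, and \<open>B\<close> the inner
  product obtained by averaging the Euclidean one over the powers of \<open>A\<close> (\<open>orbit_inner\<close>), so
  that \<open>B\<close> is \<open>A\<close>-invariant. For a point \<open>x\<close> of the exterior, the curve touches the segment from
  \<open>x\<close> to \<open>T x\<close> at its midpoint. Hence \<open>B(\<gamma>, \<gamma>') = 0\<close> at the tangency point as soon as
  \<open>B(T x, T x) = B(x, x)\<close>, and this holds if \<open>T x = A\<^sup>s x\<close> for some \<open>s\<close>. It is shown that on the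
  invariant curve \<open>T\<close> does agree with a power of \<open>A\<close>. As the invariant curve meets every tangent
  ray, \<open>B(\<gamma>, \<gamma>') = 0\<close> follows along all of \<open>\<gamma>\<close>, so \<open>B(\<gamma>, \<gamma>)\<close> is constant and \<open>\<gamma>\<close> is an ellipse.

  To compare \<open>T\<close> with the powers of \<open>A\<close>, write an exterior point as \<open>P w - w\<close>, where \<open>P w\<close> is the
  point of the curve whose tangent has direction \<open>w\<close>; this identifies the exterior with the
  punctured plane, and \<open>A\<close> commutes with \<open>P\<close>. The exponential function is then the universal
  cover of the phase cylinder, the imaginary part being the angle of the tangent direction. The
  lift \<open>F\<close> of \<open>T\<close> has the twist property both forwards and backwards.

  Consider the set of all points with \<open>F\<^sup>k z = z + 2\<pi>ir\<close>. If the angles of one orbit in it are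
  everywhere at most those of another, with equality somewhere, then the orbits are equal, since
  by the twist property distinct orbits with a common angle cross there
  (\<open>periodic_lifts_touching\<close>). Sweep the lifted invariant curve past an arbitrary point \<open>y\<close> of the
  set: at the last parameter where it is not entirely ahead of \<open>y\<close>, the two orbits touch, so they
  agree (\<open>periodic_lifts_sweep\<close>). Thus the whole set lies on the curve, and it is totally ordered
  by the angle, in a way that \<open>F\<close> respects. This elementary argument replaces Birkhoff's theorem
  that invariant curves of twist maps are graphs.

  The lift of \<open>A\<close> increases angles as well, commutes with \<open>F\<close>, and its \<open>k\<close>-th iterate is a rotation
  by \<open>m\<close> full turns with \<open>m\<close> coprime to \<open>k\<close>, because the order of \<open>A\<close> is exactly \<open>k\<close>. Therefore some
  power of it, composed with full turns, has the same \<open>k\<close>-th iterate as \<open>F\<close> on the set. Commuting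
  increasing maps with equal \<open>k\<close>-th iterates are equal (\<open>commuting_increasing_maps_eq\<close>), and so
  \<open>T\<close> is a power of \<open>A\<close> on the curve.
\<close>

section \<open>The area form of the plane\<close>

definition cross :: "complex \<Rightarrow> complex \<Rightarrow> real" where
  "cross v z = Re v * Im z - Im v * Re z"

lemma cross_add_right: "cross v (x + y) = cross v x + cross v y"
  and cross_diff_right: "cross v (x - y) = cross v x - cross v y"
  and cross_minus_left: "cross (- v) x = - cross v x"
  and cross_scale_right: "cross v (r *\<^sub>R x) = r * cross v x"
  and cross_scale_left: "cross (r *\<^sub>R v) x = r * cross v x"
  and cross_self: "cross v v = 0"
  and cross_swap: "cross v x = - cross x v"
  by (simp_all add: cross_def algebra_simps)

lemma continuous_on_cross [continuous_intros]:
  "\<lbrakk>continuous_on S f; continuous_on S g\<rbrakk> \<Longrightarrow> continuous_on S (\<lambda>x. cross (f x) (g x))"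
  unfolding cross_def by (intro continuous_intros)

lemma cross_exp: "cross (exp a) (exp b) = exp (Re a + Re b) * sin (Im b - Im a)"
  by (simp add: cross_def Re_exp Im_exp sin_diff exp_add algebra_simps)

lemma cross_eq_0_imp:
  assumes "v \<noteq> 0" "cross v z = 0"
  obtains r where "z = r *\<^sub>R v"
proof
  have "Im (z / v) = 0"
    using assms(2) by (simp add: Im_divide cross_def algebra_simps)
  hence "z / v = of_real (Re (z / v))" by (simp add: complex_eq_iff)
  thus "z = Re (z / v) *\<^sub>R v"
    using assms(1) unfolding scaleR_conv_of_real by (metis nonzero_divide_eq_eq)
qed

section \<open>Outer billiards about a smooth strictly convex body\<close>

text \<open>
  Here \<open>K\<close> is the convex body and \<open>P v\<close> the unique point of \<open>K\<close> whose oriented tangent line has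
  direction \<open>v\<close>, with \<open>K\<close> to the left of it. Uniqueness of the point (\<open>strict_support\<close>) is strict
  convexity; uniqueness of the tangent at a point (\<open>smooth\<close>) is differentiability of the
  boundary. Every statement about the dynamics below follows from these sign conditions.
\<close>

locale oval =
  fixes P :: "complex \<Rightarrow> complex" and K :: "complex set"
  assumes continuous_P: "continuous_on (- {0}) P"
    and P_in: "v \<noteq> 0 \<Longrightarrow> P v \<in> K"
    and strict_support: "\<lbrakk>v \<noteq> 0; z \<in> K; z \<noteq> P v\<rbrakk> \<Longrightarrow> 0 < cross v (z - P v)"
    and smooth: "\<lbrakk>v \<noteq> 0; w \<noteq> 0; P v = P w\<rbrakk> \<Longrightarrow> \<exists>r>0. w = r *\<^sub>R v"
    and separation: "x \<notin> K \<Longrightarrow> \<exists>v. v \<noteq> 0 \<and> cross v (x - P v) < 0"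
begin

lemma support: "\<lbrakk>v \<noteq> 0; z \<in> K\<rbrakk> \<Longrightarrow> 0 \<le> cross v (z - P v)"
  using strict_support[of v z] by (cases "z = P v") (auto simp: cross_def)

lemma P_scale:
  assumes "0 < r" "v \<noteq> 0" shows "P (r *\<^sub>R v) = P v"
proof (rule ccontr)
  assume ne: "P (r *\<^sub>R v) \<noteq> P v"
  have "0 < cross v (P (r *\<^sub>R v) - P v)"
    using strict_support[OF assms(2) P_in ne] assms by simp
  moreover have "0 < cross (r *\<^sub>R v) (P v - P (r *\<^sub>R v))"
    using strict_support[OF _ P_in[OF assms(2)], of "r *\<^sub>R v"] ne assms by simp
  hence "0 < cross v (P v - P (r *\<^sub>R v))"
    using assms by (simp add: cross_scale_left zero_less_mult_iff)
  ultimately show False by (simp add: cross_diff_right)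
qed

text \<open>
  The exterior point that sees \<open>P w\<close> as its right tangency point, at displacement \<open>w\<close>. Polar
  coordinates of \<open>w\<close> are the direction of the tangent ray and the distance along it, so the
  punctured plane serves as phase cylinder.
\<close>

definition pole :: "complex \<Rightarrow> complex" where
  "pole w = P w - w"

text \<open>
  If \<open>P v - v = P w - w\<close> with \<open>P v \<noteq> P w\<close>, the support inequalities at the two tangency points would
  give \<open>cross v w\<close> both signs.
\<close>

lemma inj_pole: "inj_on pole (- {0})"
proof (rule inj_onI)
  fix v w assume "v \<in> - {0}" "w \<in> - {0}" and eq: "pole v = pole w"
  hence nz: "v \<noteq> 0" "w \<noteq> 0" by auto
  have d: "P w - P v = w - v" using eq by (simp add: pole_def algebra_simps)
  have 1: "cross v (P w - P v) = cross v w" unfolding d by (simp add: cross_diff_right cross_self)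
  have "P v - P w = v - w" using d by (simp add: algebra_simps)
  hence 2: "cross w (P v - P w) = - cross v w"
    by (simp add: cross_diff_right cross_self cross_swap[of w v])
  have "P v = P w"
    using strict_support[OF nz(1) P_in[OF nz(2)]] strict_support[OF nz(2) P_in[OF nz(1)]] 1 2 by force
  thus "v = w" using d by simp
qed

lemma outside_tangent:
  assumes "w \<noteq> 0" "r \<noteq> 0" shows "P w + r *\<^sub>R w \<notin> K"
  using strict_support[OF assms(1), of "P w + r *\<^sub>R w"] assms
  by (auto simp: cross_scale_right cross_self)

lemma pole_notin: "w \<noteq> 0 \<Longrightarrow> pole w \<notin> K"
  using outside_tangent[of w "-1"] by (simp add: pole_def)

lemma plus_notin: "w \<noteq> 0 \<Longrightarrow> P w + w \<notin> K"
  using outside_tangent[of w 1] by simp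

text \<open>
  Let a supporting line that separates \<open>x\<close> from \<open>K\<close> roll around \<open>K\<close> by half a turn: \<open>x\<close> passes from
  its right to its left, so some supporting line in between contains \<open>x\<close>. The sign at the start
  decides on which side of the tangency point \<open>x\<close> lies.
\<close>

lemma ex_right_tangent:
  assumes "x \<notin> K"
  obtains w where "w \<noteq> 0" "x = pole w"
proof -
  obtain v where v: "v \<noteq> 0" "cross v (x - P v) < 0"
    using separation[OF assms] by auto
  define e where "e = (\<lambda>\<phi>. cis (Arg v + \<phi>))"
  have e_nz: "e \<phi> \<noteq> 0" for \<phi> by (simp add: e_def)
  define g where "g = (\<lambda>\<phi>. cross (e \<phi>) (x - P (e \<phi>)))"
  have v_eq: "v = cmod v *\<^sub>R e 0"
    using v(1) by (simp add: e_def scaleR_conv_of_real flip: rcis_def) (simp add: rcis_cmod_Arg)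
  have "P v = P (e 0)" using P_scale[of "cmod v" "e 0"] v_eq v(1) e_nz by simp
  hence "cmod v * g 0 < 0"
    using v(2) unfolding g_def cross_scale_left[symmetric] v_eq[symmetric] by simp
  hence g0: "g 0 < 0" by (simp add: mult_less_0_iff)
  have e_pi: "e pi = - e 0" by (simp add: e_def cis_mult[symmetric])
  have "g 0 + g pi = cross (e 0) (P (e pi) - P (e 0))"
    by (simp add: g_def e_pi cross_minus_left cross_diff_right)
  also have "\<dots> \<ge> 0" using support P_in e_nz by simp
  finally have gpi: "g pi > 0" using g0 by simp
  have "continuous_on {0..pi} (\<lambda>\<phi>. P (e \<phi>))"
    by (rule continuous_on_compose2[OF continuous_P]) (auto simp: e_def intro!: continuous_intros)
  hence "continuous_on {0..pi} g"
    unfolding g_def by (intro continuous_intros) (auto simp: e_def intro!: continuous_intros)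
  then obtain \<phi> where \<phi>: "0 \<le> \<phi>" "\<phi> \<le> pi" "g \<phi> = 0"
    using IVT'[of g 0 0 pi] g0 gpi by auto
  hence \<phi>': "0 < \<phi>" "\<phi> < pi" using g0 gpi by (cases "\<phi> = 0"; cases "\<phi> = pi"; force)+
  obtain r where r: "x - P (e \<phi>) = r *\<^sub>R e \<phi>"
    using cross_eq_0_imp[OF e_nz[of \<phi>]] \<phi>(3) unfolding g_def by metis
  have "g 0 = cross (e 0) (P (e \<phi>) - P (e 0)) + r * cross (e 0) (e \<phi>)"
    using r unfolding g_def cross_scale_right[symmetric] cross_add_right[symmetric]
    by (simp add: algebra_simps)
  moreover have "cross (e 0) (P (e \<phi>) - P (e 0)) \<ge> 0" using support P_in e_nz by simp
  ultimately have "r * cross (e 0) (e \<phi>) < 0" using g0 by simp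
  moreover have "cross (e 0) (e \<phi>) = sin \<phi>"
    using sin_diff[of "Arg v + \<phi>" "Arg v"] by (simp add: e_def cross_def algebra_simps)
  moreover have "sin \<phi> > 0" using \<phi>' by (simp add: sin_gt_zero)
  ultimately have "r < 0" by (simp add: mult_less_0_iff)
  hence P_eq: "P ((- r) *\<^sub>R e \<phi>) = P (e \<phi>)" by (intro P_scale) (auto simp: e_nz)
  show ?thesis
  proof
    show "(- r) *\<^sub>R e \<phi> \<noteq> 0" using \<open>r < 0\<close> e_nz by simp
    show "x = pole ((- r) *\<^sub>R e \<phi>)"
      unfolding pole_def P_eq using r by (simp add: algebra_simps)
  qed
qed

lemma pole_image: "pole ` (- {0}) = - K"
proof
  show "pole ` (- {0}) \<subseteq> - K" using pole_notin by auto
  show "- K \<subseteq> pole ` (- {0})"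
  proof
    fix x assume "x \<in> - K"
    then obtain w where "w \<noteq> 0" "x = pole w" using ex_right_tangent[of x] by blast
    thus "x \<in> pole ` (- {0})" by blast
  qed
qed

lemma continuous_pole: "continuous_on (- {0}) pole"
  unfolding pole_def by (intro continuous_intros continuous_P)

definition unpole :: "complex \<Rightarrow> complex" where
  "unpole = the_inv_into (- {0}) pole"

lemma unpole_pole [simp]: "w \<noteq> 0 \<Longrightarrow> unpole (pole w) = w"
  unfolding unpole_def by (rule the_inv_into_f_f[OF inj_pole]) simp

lemma pole_unpole [simp]: "x \<notin> K \<Longrightarrow> pole (unpole x) = x"
  by (metis ex_right_tangent unpole_pole)

lemma unpole_nz [simp]: "x \<notin> K \<Longrightarrow> unpole x \<noteq> 0"
  by (metis ex_right_tangent unpole_pole)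

text \<open>
  Invariance of domain spares a direct study of how tangency points move with \<open>x\<close>.
\<close>

lemma continuous_unpole: "continuous_on (- K) unpole"
proof -
  obtain g where "homeomorphism (- {0}) (pole ` (- {0})) pole g"
    by (rule invariance_of_domain_homeomorphism[OF _ continuous_pole _ inj_pole]) auto
  hence g: "continuous_on (- K) g" "\<And>x. x \<in> - {0} \<Longrightarrow> g (pole x) = x"
    unfolding homeomorphism_def pole_image by auto
  have "g x = unpole x" if x: "x \<in> - K" for x
  proof -
    obtain w where "w \<noteq> 0" "x = pole w" using ex_right_tangent[of x] x by blast
    thus ?thesis using g(2) by simp
  qed
  thus ?thesis using g(1) continuous_on_cong[of "- K" "- K" g unpole] by blast
qed

text \<open>
  The outer billiard map in the coordinate \<open>w\<close>: the image \<open>P w + w\<close> of \<open>P w - w\<close>, expressed by its own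
  right tangency.
\<close>

definition bounce :: "complex \<Rightarrow> complex" where
  "bounce w = unpole (P w + w)"

lemma bounce_nz [simp]: "w \<noteq> 0 \<Longrightarrow> bounce w \<noteq> 0"
  by (simp add: bounce_def plus_notin)

lemma pole_bounce: "w \<noteq> 0 \<Longrightarrow> P (bounce w) - bounce w = P w + w"
  unfolding bounce_def using plus_notin pole_unpole by (simp flip: pole_def)

lemma continuous_bounce: "continuous_on (- {0}) bounce"
  unfolding bounce_def
  by (rule continuous_on_compose2[OF continuous_unpole])
     (auto intro!: continuous_intros continuous_P simp: plus_notin)

text \<open>
  The direction advances by less than half a turn, because the next tangency point lies to the left
  of the tangent line at \<open>P w\<close> and differs from \<open>P w\<close> by \<open>w + bounce w\<close>.
\<close>

lemma cross_bounce:
  assumes "w \<noteq> 0" shows "0 < cross w (bounce w)"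
proof -
  have d: "P (bounce w) - P w = w + bounce w" using pole_bounce[OF assms] by (simp add: algebra_simps)
  have "P (bounce w) \<noteq> P w"
  proof
    assume "P (bounce w) = P w"
    moreover from this obtain r where "r > 0" "bounce w = r *\<^sub>R w" using smooth[of w "bounce w"] assms by auto
    ultimately have "(1 + r) *\<^sub>R w = 0" using d by (simp add: algebra_simps)
    thus False using assms \<open>r > 0\<close> by simp
  qed
  from strict_support[OF assms P_in this] assms
  have "0 < cross w (w + bounce w)" by (simp flip: d)
  thus ?thesis by (simp add: cross_add_right cross_self)
qed

text \<open>
  Moving the exterior point \<open>P w + w\<close> outwards on its tangent ray takes it to the right of the tangent
  line at the old tangency point \<open>P (bounce w)\<close>, so the new tangency comes later.
\<close>

lemma forward_twist:
  assumes "w \<noteq> 0" "1 < c"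
  shows "0 < cross (bounce w) (bounce (c *\<^sub>R w))"
proof -
  let ?u = "bounce w" and ?v = "bounce (c *\<^sub>R w)"
  have nz: "?u \<noteq> 0" "?v \<noteq> 0" "c *\<^sub>R w \<noteq> 0" using assms by auto
  have "P ?v - P ?u = (c - 1) *\<^sub>R w - ?u + ?v"
    using pole_bounce[OF assms(1)] pole_bounce[OF nz(3)] P_scale[of c w] assms
    by (simp add: algebra_simps)
  moreover have "0 \<le> cross ?u (P ?v - P ?u)" using support P_in nz by simp
  ultimately have "0 \<le> (c - 1) * cross ?u w + cross ?u ?v"
    by (simp add: cross_diff_right cross_add_right cross_scale_right cross_self)
  moreover have "(c - 1) * cross ?u w < 0"
    using cross_bounce[OF assms(1)] assms(2) cross_swap[of ?u w] by (simp add: mult_less_0_iff)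
  ultimately show ?thesis by simp
qed

text \<open>
  The same comparison for the previous tangency, with the order reversed. Both directions together
  make two orbits that share an angle cross there.
\<close>

lemma backward_twist:
  assumes "v \<noteq> 0" "w \<noteq> 0" "1 < c" "bounce w = c *\<^sub>R bounce v"
  shows "0 < cross w v"
proof -
  let ?u = "bounce v"
  have "P w - P v = v - w - (c - 1) *\<^sub>R ?u"
    using pole_bounce[OF assms(1)] pole_bounce[OF assms(2)] P_scale[of c ?u] assms
    by (simp add: algebra_simps)
  moreover have "0 \<le> cross v (P w - P v)" using support P_in assms by simp
  ultimately have "0 \<le> - cross v w - (c - 1) * cross v ?u"
    by (simp add: cross_diff_right cross_scale_right cross_self)
  moreover have "(c - 1) * cross v ?u > 0" using cross_bounce[OF assms(1)] assms(3) by simp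
  ultimately show ?thesis using cross_swap[of v w] by simp
qed

end

section \<open>Lifts to the universal cover\<close>

definition turn :: "int \<Rightarrow> complex" where
  "turn j = Complex 0 (2 * pi * of_int j)"

lemma Re_turn [simp]: "Re (turn j) = 0" and Im_turn [simp]: "Im (turn j) = 2 * pi * of_int j"
  by (simp_all add: turn_def)

lemma turn_0 [simp]: "turn 0 = 0" and turn_add: "turn (i + j) = turn i + turn j"
  and turn_minus: "turn (- j) = - turn j"
  by (simp_all add: complex_eq_iff algebra_simps)

lemma exp_turn [simp]: "exp (turn j) = 1"
  unfolding exp_eq_1 by (auto intro: exI[of _ j])

lemma exp_eq_1_turn: "exp z = 1 \<Longrightarrow> \<exists>j. z = turn j"
  using exp_eq_1[of z] by (auto simp: complex_eq_iff simp del: exp_eq_1)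

lemma exp_eq_1_constant:
  assumes S: "connected S" "continuous_on S q" and 1: "\<And>x. x \<in> S \<Longrightarrow> exp (q x) = 1"
  obtains j where "\<And>x. x \<in> S \<Longrightarrow> q x = turn j"
proof (cases "S = {}")
  case False
  have "\<exists>e>0. \<forall>y. y \<in> S \<and> q y \<noteq> q x \<longrightarrow> e \<le> norm (q y - q x)" if x: "x \<in> S" for x
  proof (intro exI[of _ "2 * pi"] conjI allI impI)
    fix y assume y: "y \<in> S \<and> q y \<noteq> q x"
    obtain i where i: "q x = turn i" using exp_eq_1_turn[OF 1[OF x]] by blast
    obtain j where j: "q y = turn j" using exp_eq_1_turn[OF 1[of y]] y by blast
    have "i \<noteq> j" using i j y by auto
    hence "1 \<le> \<bar>real_of_int (j - i)\<bar>" by linarith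
    hence "2 * pi \<le> 2 * pi * \<bar>real_of_int (j - i)\<bar>" by simp
    also have "\<dots> = \<bar>2 * pi * real_of_int (j - i)\<bar>" by (simp only: abs_mult) simp
    also have "\<dots> = \<bar>Im (q y - q x)\<bar>" unfolding i j by (simp add: algebra_simps)
    also have "\<dots> \<le> norm (q y - q x)" by (rule abs_Im_le_cmod)
    finally show "2 * pi \<le> norm (q y - q x)" .
  qed simp
  hence "q constant_on S" using continuous_discrete_range_constant[OF S] by blast
  then obtain y where y: "\<And>x. x \<in> S \<Longrightarrow> q x = y" unfolding constant_on_def by blast
  obtain x where "x \<in> S" using False by blast
  hence "exp y = 1" using y 1 by force
  thus ?thesis using that y exp_eq_1_turn by blast
qed (use that in blast)

text \<open>
  The inequality \<open>f x < g x\<close> propagates: apply \<open>f\<close> to \<open>f\<^sup>n x < g\<^sup>n x\<close>, move \<open>f\<close> past \<open>g\<^sup>n\<close>, and apply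
  \<open>g\<^sup>n\<close> to \<open>f x < g x\<close>. The order is that of a real-valued \<open>\<theta>\<close>, which is the angle in
  the applications.
\<close>

lemma power_less_of_commuting_increasing:
  fixes \<theta> :: "'a \<Rightarrow> real"
  assumes closed: "f ` S \<subseteq> S" "g ` S \<subseteq> S"
    and mono_f: "\<And>x y. \<lbrakk>x \<in> S; y \<in> S; \<theta> x < \<theta> y\<rbrakk> \<Longrightarrow> \<theta> (f x) < \<theta> (f y)"
    and mono_g: "\<And>x y. \<lbrakk>x \<in> S; y \<in> S; \<theta> x < \<theta> y\<rbrakk> \<Longrightarrow> \<theta> (g x) < \<theta> (g y)"
    and comm: "\<And>x. x \<in> S \<Longrightarrow> f (g x) = g (f x)"
    and x: "x \<in> S" and less: "\<theta> (f x) < \<theta> (g x)"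
  shows "\<theta> ((f ^^ Suc n) x) < \<theta> ((g ^^ Suc n) x)"
proof (induction n)
  case (Suc n)
  have cl: "(f ^^ i) y \<in> S" "(g ^^ i) y \<in> S" if "y \<in> S" for i y
    using closed that by (induction i) auto
  have mono: "\<theta> ((g ^^ i) u) < \<theta> ((g ^^ i) v)" if "u \<in> S" "v \<in> S" "\<theta> u < \<theta> v" for i u v
    using that by (induction i) (auto intro!: mono_g cl)
  have comm': "f ((g ^^ i) y) = (g ^^ i) (f y)" if "y \<in> S" for i y
    using that by (induction i) (auto simp: comm cl)
  have "\<theta> ((f ^^ Suc (Suc n)) x) = \<theta> (f ((f ^^ Suc n) x))" by simp
  also have "\<dots> < \<theta> (f ((g ^^ Suc n) x))" by (rule mono_f[OF cl(1)[OF x] cl(2)[OF x] Suc])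
  also have "\<dots> = \<theta> ((g ^^ Suc n) (f x))" by (simp only: comm'[OF x])
  also have "\<dots> < \<theta> ((g ^^ Suc n) (g x))" using closed x by (intro mono less) auto
  also have "\<dots> = \<theta> ((g ^^ Suc (Suc n)) x)" by (simp add: funpow_swap1)
  finally show ?case .
qed (use less in simp)

lemma commuting_increasing_maps_eq:
  fixes \<theta> :: "'a \<Rightarrow> real"
  assumes "f ` S \<subseteq> S" "g ` S \<subseteq> S"
    and "\<And>x y. \<lbrakk>x \<in> S; y \<in> S; \<theta> x < \<theta> y\<rbrakk> \<Longrightarrow> \<theta> (f x) < \<theta> (f y)"
    and "\<And>x y. \<lbrakk>x \<in> S; y \<in> S; \<theta> x < \<theta> y\<rbrakk> \<Longrightarrow> \<theta> (g x) < \<theta> (g y)"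
    and "\<And>x. x \<in> S \<Longrightarrow> f (g x) = g (f x)"
    and "x \<in> S" and "0 < k" and eq: "\<theta> ((f ^^ k) x) = \<theta> ((g ^^ k) x)"
  shows "\<theta> (f x) = \<theta> (g x)"
proof -
  obtain n where k: "k = Suc n" using \<open>0 < k\<close> gr0_implies_Suc by blast
  have "\<not> \<theta> (f x) < \<theta> (g x)"
    using power_less_of_commuting_increasing[of f S g \<theta> x n] assms unfolding k by fastforce
  moreover have "\<not> \<theta> (g x) < \<theta> (f x)"
    using power_less_of_commuting_increasing[of g S f \<theta> x n] assms unfolding k by fastforce
  ultimately show ?thesis by simp
qed

text \<open>
  Such a \<open>D\<close> is a periodic function plus a linear one of positive slope.
\<close>

lemma drift:
  fixes D :: "real \<Rightarrow> real"
  assumes cont: "continuous_on UNIV D" and step: "\<forall>s. D (s + 1) = D s + c" and c: "0 < c"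
  shows drift_eventually_pos: "\<exists>b. \<forall>s\<ge>b. 0 < D s"
    and drift_ex_nonpos: "\<exists>s. D s \<le> 0"
proof -
  have steps: "D (s + real n) = D s + real n * c" for s n
  proof (induction n)
    case (Suc n)
    have "D (s + real (Suc n)) = D ((s + real n) + 1)" by (simp add: algebra_simps)
    thus ?case unfolding step[rule_format] Suc by (simp add: algebra_simps)
  qed simp
  have "\<exists>x\<in>{0..1}. \<forall>y\<in>{0..1}. D x \<le> D y"
    by (rule continuous_attains_inf) (auto intro: continuous_on_subset[OF cont])
  then obtain s0 where m: "\<And>s. s \<in> {0..1} \<Longrightarrow> D s0 \<le> D s" by blast
  obtain N :: nat where N: "- D s0 < real N * c" using reals_Archimedean3[OF c] by blast
  have "0 < D s" if "s \<ge> real N" for s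
  proof -
    have "0 \<le> s" using that of_nat_0_le_iff[of N] by linarith
    hence s: "s = frac s + real (nat \<lfloor>s\<rfloor>)" by (simp add: frac_def)
    have "N \<le> nat \<lfloor>s\<rfloor>" using that by (simp add: le_nat_floor)
    hence "real N * c \<le> real (nat \<lfloor>s\<rfloor>) * c" using c by simp
    moreover have "D s0 \<le> D (frac s)" by (intro m) (simp add: frac_lt_1 less_imp_le)
    moreover have "D s = D (frac s) + real (nat \<lfloor>s\<rfloor>) * c" using steps s by metis
    ultimately show ?thesis using N by linarith
  qed
  thus "\<exists>b. \<forall>s\<ge>b. 0 < D s" by blast
  obtain M :: nat where M: "D 0 < real M * c" using reals_Archimedean3[OF c] by blast
  have "D 0 = D (- real M) + real M * c" using steps[of "- real M" M] by simp
  hence "D (- real M) \<le> 0" using M by simp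
  thus "\<exists>s. D s \<le> 0" by blast
qed

lemma exp_same_Im: "Im a = Im b \<Longrightarrow> exp b = exp (Re b - Re a) *\<^sub>R exp a"
  by (auto simp: complex_eq_iff Re_exp Im_exp exp_diff)

section \<open>Periodic orbits of the lifted billiard map\<close>

context oval
begin

text \<open>
  A lift of \<open>bounce\<close> along \<open>exp\<close>. The principal logarithm is continuous here because the quotient lies
  in the upper half plane, and it selects the advance of the angle between \<open>0\<close> and \<open>\<pi>\<close>.
\<close>

definition lift :: "complex \<Rightarrow> complex" where
  "lift z = z + Ln (bounce (exp z) / exp z)"

lemma exp_lift: "exp (lift z) = bounce (exp z)"
  by (simp add: lift_def exp_add)

lemma Im_bounce_ratio: "0 < Im (bounce (exp z) / exp z)"
proof -
  have "0 < cross (exp z) (bounce (exp z))" by (rule cross_bounce) simp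
  thus ?thesis
    by (auto simp: Im_divide cross_def algebra_simps zero_less_divide_iff intro!: sum_power2_gt_zero_iff[THEN iffD2])
qed

lemma Im_lift: "Im z < Im (lift z)" "Im (lift z) < Im z + pi"
  using Im_Ln_pos_lt_imp[OF Im_bounce_ratio[of z]] by (auto simp: lift_def)

lemma continuous_lift: "continuous_on S lift"
  unfolding lift_def
proof (intro continuous_intros continuous_on_compose2[OF continuous_bounce])
  fix z show "bounce (exp z) / exp z \<notin> \<real>\<^sub>\<le>\<^sub>0"
    using Im_bounce_ratio[of z] by (auto simp: complex_nonpos_Reals_iff)
qed auto

lemma lift_turn: "lift (z + turn j) = lift z + turn j"
  by (simp add: lift_def exp_add)

lemma continuous_lift_funpow: "continuous_on S (lift ^^ i)"
proof (induction i)
  case (Suc i) thus ?case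
    by (auto intro: continuous_on_compose2[OF continuous_lift[of UNIV]])
qed (simp add: id_def)

lemma lift_funpow_turn: "(lift ^^ i) (z + turn j) = (lift ^^ i) z + turn j"
  by (induction i) (auto simp: lift_turn)

lemma exp_lift_funpow: "exp ((lift ^^ i) z) = (bounce ^^ i) (exp z)"
  by (induction i) (auto simp: exp_lift)

lemma lift_forward_twist:
  assumes "Im a = Im b" "Re a < Re b" shows "Im (lift a) < Im (lift b)"
proof -
  have "0 < cross (exp (lift a)) (exp (lift b))"
    unfolding exp_lift exp_same_Im[OF assms(1)] by (rule forward_twist) (use assms in auto)
  hence s: "0 < sin (Im (lift b) - Im (lift a))" by (simp add: cross_exp zero_less_mult_iff)
  show ?thesis
  proof (rule ccontr)
    assume "\<not> ?thesis"
    hence "0 \<le> sin (Im (lift a) - Im (lift b))"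
      using Im_lift[of a] Im_lift[of b] assms by (intro sin_ge_zero) auto
    thus False using s sin_minus[of "Im (lift b) - Im (lift a)"] by simp
  qed
qed

lemma lift_backward_twist:
  assumes "Im (lift a) = Im (lift b)" "Re (lift a) < Re (lift b)" shows "Im b < Im a"
proof -
  have "0 < cross (exp b) (exp a)"
    by (rule backward_twist[where c = "exp (Re (lift b) - Re (lift a))"])
       (use exp_same_Im[OF assms(1)] assms(2) in \<open>auto simp: exp_lift\<close>)
  hence s: "0 < sin (Im a - Im b)" by (simp add: cross_exp zero_less_mult_iff)
  show ?thesis
  proof (rule ccontr)
    assume "\<not> ?thesis"
    hence "0 \<le> sin (Im b - Im a)"
      using Im_lift[of a] Im_lift[of b] assms by (intro sin_ge_zero) auto
    thus False using s sin_minus[of "Im a - Im b"] by simp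
  qed
qed

text \<open>
  The lifts of the points that return after \<open>k\<close> steps and \<open>r\<close> full turns.
\<close>

definition periodic_lifts :: "nat \<Rightarrow> int \<Rightarrow> complex set" where
  "periodic_lifts k r = {z. (lift ^^ k) z = z + turn r}"

lemma periodic_lifts_funpow_mult:
  assumes "z \<in> periodic_lifts k r"
  shows "(lift ^^ (i + q * k)) z = (lift ^^ i) z + turn (int q * r)"
proof -
  have "(lift ^^ (q * k)) z = z + turn (int q * r)"
  proof (induction q)
    case (Suc q)
    have "(lift ^^ (Suc q * k)) z = (lift ^^ k) ((lift ^^ (q * k)) z)"
      by (simp add: funpow_add)
    also have "\<dots> = z + turn (int (Suc q) * r)"
      unfolding Suc lift_funpow_turn using assms
      by (simp add: periodic_lifts_def algebra_simps turn_add)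
    finally show ?case .
  qed simp
  thus ?thesis by (simp add: funpow_add lift_funpow_turn)
qed

text \<open>
  At a contact the angles agree. If the distances differed, the twist property would put one orbit
  ahead at the next step or the other one ahead at the previous step, against the assumed order.
\<close>

lemma periodic_lifts_touching:
  assumes "0 < k" and z: "z \<in> periodic_lifts k r" and y: "y \<in> periodic_lifts k r"
    and le: "\<And>i. i < k \<Longrightarrow> Im ((lift ^^ i) z) \<le> Im ((lift ^^ i) y)"
    and j: "j < k" "Im ((lift ^^ j) z) = Im ((lift ^^ j) y)"
  shows "z = y"
proof -
  have per: "Im ((lift ^^ i) x) = Im ((lift ^^ (i mod k)) x) + 2 * pi * (int (i div k) * r)"
    if "x \<in> periodic_lifts k r" for x i
    using periodic_lifts_funpow_mult[OF that, of "i mod k" "i div k"] by simp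
  have le': "Im ((lift ^^ i) z) \<le> Im ((lift ^^ i) y)" for i
    using per[OF z, of i] per[OF y, of i] le[of "i mod k"] \<open>0 < k\<close> by simp
  \<comment> \<open>The contact is moved one period ahead, to the index \<open>Suc n\<close>, so that it has a predecessor
    even if \<open>j = 0\<close>.\<close>
  define n where "n = j + k - 1"
  have Suc_n: "Suc n = j + k" using \<open>0 < k\<close> by (simp add: n_def)
  define a where "a = (lift ^^ n) z"
  define b where "b = (lift ^^ n) y"
  have "lift a = (lift ^^ (j + k)) z" "lift b = (lift ^^ (j + k)) y"
    by (simp_all add: a_def b_def flip: Suc_n)
  hence Im_eq: "Im (lift a) = Im (lift b)"
    using j(2) periodic_lifts_funpow_mult[OF z, of j 1] periodic_lifts_funpow_mult[OF y, of j 1]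
    by simp
  have le_ab: "Im a \<le> Im b" "Im (lift (lift a)) \<le> Im (lift (lift b))"
    using le'[of n] le'[of "Suc (Suc n)"] by (simp_all add: a_def b_def)
  have "Re (lift a) = Re (lift b)"
    using lift_backward_twist[OF Im_eq] lift_forward_twist[OF Im_eq[symmetric]] le_ab
    by linarith
  hence "(lift ^^ Suc n) z = (lift ^^ Suc n) y"
    using Im_eq by (simp add: a_def b_def complex_eq_iff)
  hence eq: "(lift ^^ (i + Suc n)) z = (lift ^^ (i + Suc n)) y" for i
    by (simp only: funpow_add comp_apply)
  have "Suc n \<le> Suc n * k" using \<open>0 < k\<close> by (cases k) auto
  hence "(lift ^^ (0 + Suc n * k)) z = (lift ^^ (0 + Suc n * k)) y"
    using eq[of "Suc n * k - Suc n"] by (simp only: le_add_diff_inverse2 add_0)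
  thus ?thesis
    unfolding periodic_lifts_funpow_mult[OF z] periodic_lifts_funpow_mult[OF y] by simp
qed

text \<open>
  The curve \<open>Z\<close> starts behind \<open>y\<close> and ends ahead of it. At the last parameter where one of the
  first \<open>k\<close> angles along the orbit of \<open>Z s\<close> is not ahead of that of \<open>y\<close>, all these angles are at least
  those of \<open>y\<close> by continuity, hence the orbits touch and agree.
\<close>

lemma periodic_lifts_sweep:
  fixes Z :: "real \<Rightarrow> complex"
  assumes "0 < k" and cont: "continuous_on UNIV Z" and step: "\<forall>s. Z (s + 1) = Z s + turn n"
    and "0 < n" and Z: "\<forall>s. Z s \<in> periodic_lifts k r" and y: "y \<in> periodic_lifts k r"
  obtains s where "Z s = y"
    and "\<And>s' i. \<lbrakk>s < s'; i < k\<rbrakk> \<Longrightarrow> Im ((lift ^^ i) y) < Im ((lift ^^ i) (Z s'))"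
proof -
  define D where "D = (\<lambda>i s. Im ((lift ^^ i) (Z s)) - Im ((lift ^^ i) y))"
  have cD: "continuous_on UNIV (D i)" for i
    unfolding D_def
    by (intro continuous_intros continuous_on_compose2[OF continuous_lift_funpow cont]) auto
  have sD: "\<forall>s. D i (s + 1) = D i s + 2 * pi * of_int n" for i
    by (simp add: D_def step lift_funpow_turn)
  have pos: "0 < 2 * pi * real_of_int n" using \<open>0 < n\<close> by simp
  define S where "S = (\<Union>i<k. {s. D i s \<le> 0})"
  have "closed S" unfolding S_def
    by (intro closed_UN ballI closed_Collect_le cD continuous_intros) auto
  have "S \<noteq> {}"
    using drift_ex_nonpos[OF cD sD pos, of 0] \<open>0 < k\<close> unfolding S_def by fastforce
  obtain b where b: "\<And>i s. b i \<le> s \<Longrightarrow> 0 < D i s"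
    using drift_eventually_pos[OF cD sD pos] by metis
  have "bdd_above S"
  proof (rule bdd_aboveI)
    fix s assume "s \<in> S"
    then obtain i where i: "i < k" "D i s \<le> 0" by (auto simp: S_def)
    hence "s < b i" using b[of i s] by force
    also have "b i \<le> Max (b ` {..<k})" using i by (intro Max_ge) auto
    finally show "s \<le> Max (b ` {..<k})" by simp
  qed
  define s where "s = Sup S"
  have "s \<in> S" unfolding s_def
    by (rule closed_contains_Sup) fact+
  have above: "0 < D i s'" if "s < s'" "i < k" for s' i
  proof (rule ccontr)
    assume "\<not> ?thesis"
    hence "s' \<in> S" using that by (auto simp: S_def not_less)
    hence "s' \<le> s" unfolding s_def using \<open>bdd_above S\<close> by (rule cSup_upper)
    thus False using that by simp
  qed
  have at: "0 \<le> D i s" if "i < k" for i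
  proof (rule tendsto_lowerbound)
    show "(D i \<longlongrightarrow> D i s) (at_right s)"
      using cD[of i] by (auto simp: continuous_on_def intro: tendsto_within_subset)
    show "\<forall>\<^sub>F x in at_right s. 0 \<le> D i x"
      using above that by (auto simp: eventually_at_right_field intro!: exI[of _ "s + 1"] less_imp_le)
  qed simp
  obtain j where j: "j < k" "D j s \<le> 0" using \<open>s \<in> S\<close> by (auto simp: S_def)
  have "y = Z s"
    using at at[OF j(1)] j by (intro periodic_lifts_touching[OF \<open>0 < k\<close> y Z[rule_format], where j = j]) (auto simp: D_def intro: order.antisym)
  thus ?thesis using above that unfolding D_def by force
qed

text \<open>
  Both points lie on the curve, and the order of their last parameters decides.
\<close>

lemma periodic_lifts_total_order:
  fixes Z :: "real \<Rightarrow> complex"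
  assumes "0 < k" "continuous_on UNIV Z" "\<forall>s. Z (s + 1) = Z s + turn n" "0 < n"
    "\<forall>s. Z s \<in> periodic_lifts k r"
    and x: "x \<in> periodic_lifts k r" and y: "y \<in> periodic_lifts k r"
  shows "x = y \<or> (\<forall>i<k. Im ((lift ^^ i) x) < Im ((lift ^^ i) y))
                \<or> (\<forall>i<k. Im ((lift ^^ i) y) < Im ((lift ^^ i) x))"
proof -
  note sweep = periodic_lifts_sweep[OF assms(1-5)]
  obtain s where s: "Z s = x"
    "\<And>s' i. \<lbrakk>s < s'; i < k\<rbrakk> \<Longrightarrow> Im ((lift ^^ i) x) < Im ((lift ^^ i) (Z s'))"
    using sweep[OF x] by blast
  obtain t where t: "Z t = y"
    "\<And>s' i. \<lbrakk>t < s'; i < k\<rbrakk> \<Longrightarrow> Im ((lift ^^ i) y) < Im ((lift ^^ i) (Z s'))"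
    using sweep[OF y] by blast
  consider "s < t" | "s = t" | "t < s" by linarith
  thus ?thesis
  proof cases
    case 1 thus ?thesis using s(2)[of t] t(1) by blast
  next
    case 2 thus ?thesis using s(1) t(1) by simp
  next
    case 3 thus ?thesis using t(2)[of s] s(1) by blast
  qed
qed

end

section \<open>Linear maps of finite order\<close>

text \<open>
  Multiplication by \<open>\<alpha>\<close> and by \<open>\<beta>\<close> after conjugation are the complex linear and antilinear
  parts; the determinant is \<open>\<bar>\<alpha>\<bar>\<^sup>2 - \<bar>\<beta>\<bar>\<^sup>2\<close>.
\<close>

lemma linear_complex_form:
  fixes A :: "complex \<Rightarrow> complex"
  assumes "linear A"
  obtains \<alpha> \<beta> where "\<And>z. A z = \<alpha> * z + \<beta> * cnj z"
proof
  fix z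
  have "z = Re z *\<^sub>R 1 + Im z *\<^sub>R \<i>" by (simp add: complex_eq_iff)
  hence "A z = A (Re z *\<^sub>R 1 + Im z *\<^sub>R \<i>)" by (rule arg_cong)
  also have "\<dots> = Re z *\<^sub>R A 1 + Im z *\<^sub>R A \<i>"
    by (simp only: linear_add[OF assms] linear_cmul[OF assms])
  also have "\<dots> = (A 1 - \<i> * A \<i>) / 2 * z + (A 1 + \<i> * A \<i>) / 2 * cnj z"
    by (simp add: complex_eq_iff field_simps)
  finally show "A z = (A 1 - \<i> * A \<i>) / 2 * z + (A 1 + \<i> * A \<i>) / 2 * cnj z" .
qed

lemma cross_complex_form:
  assumes "\<And>z. A z = \<alpha> * z + \<beta> * cnj z"
  shows "cross (A x) (A y) = ((cmod \<alpha>)\<^sup>2 - (cmod \<beta>)\<^sup>2) * cross x y"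
  unfolding assms cross_def cmod_power2 by (simp add: power2_eq_square algebra_simps)

lemma funpow_eigenvector:
  fixes A :: "'a::real_vector \<Rightarrow> 'a"
  assumes "linear A" "A v = r *\<^sub>R v" shows "(A ^^ n) v = r ^ n *\<^sub>R v"
  by (induction n) (simp_all add: linear_cmul[OF assms(1)] assms(2) mult.commute)

text \<open>
  The determinant is a root of unity, hence \<open>\<plusminus>1\<close>. In the case \<open>-1\<close> the eigenvalues are real, with
  product \<open>-1\<close>, and the positive one is a root of unity, hence \<open>1\<close>. So the trace vanishes and the
  map is an involution.
\<close>

lemma det_pos_of_order_ge_3:
  assumes lin: "linear A" and form: "\<And>z. A z = \<alpha> * z + \<beta> * cnj z"
    and ord: "map_order A k" and k: "3 \<le> k"
  shows "cmod \<beta> < cmod \<alpha>"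
proof -
  define D where "D = (cmod \<alpha>)\<^sup>2 - (cmod \<beta>)\<^sup>2"
  have Ak: "(A ^^ k) z = z" for z using ord by (simp add: map_order_def)
  have "cross ((A ^^ n) x) ((A ^^ n) y) = D ^ n * cross x y" for n x y
    by (induction n) (simp_all add: cross_complex_form[of A, OF form, folded D_def])
  from this[of k 1 \<i>] have Dk: "D ^ k = 1" by (simp add: Ak cross_def)
  hence "\<bar>D\<bar> ^ k = 1" by (simp flip: power_abs)
  hence "\<bar>D\<bar> = 1" using k power_eq_imp_eq_base[of "\<bar>D\<bar>" k 1] by simp
  moreover have "D \<noteq> -1"
  proof
    assume D: "D = -1"
    define \<tau> where "\<tau> = 2 * Re \<alpha>"
    have \<tau>D: "of_real \<tau> = \<alpha> + cnj \<alpha>" "of_real D = \<alpha> * cnj \<alpha> - \<beta> * cnj \<beta>"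
      by (auto simp: \<tau>_def D_def complex_eq_iff cmod_power2) (simp add: power2_eq_square)
    \<comment> \<open>Cayley--Hamilton, with trace \<open>\<tau>\<close> and determinant \<open>-1\<close>.\<close>
    have ch: "A (A z) = \<tau> *\<^sub>R A z + z" for z
    proof -
      have "A (A z) = of_real \<tau> * A z - of_real D * z"
        unfolding \<tau>D form by (simp add: algebra_simps)
      thus ?thesis by (simp add: D scaleR_conv_of_real)
    qed
    \<comment> \<open>The positive root of \<open>l\<^sup>2 = \<tau> l + 1\<close>; the other root is \<open>\<tau> - l\<close>, so \<open>A - (\<tau> - l)\<close> maps into the
      eigenspace of \<open>l\<close>.\<close>
    define l where "l = (\<tau> + sqrt (\<tau>\<^sup>2 + 4)) / 2"
    have "\<bar>\<tau>\<bar> < sqrt (\<tau>\<^sup>2 + 4)" by (rule real_less_rsqrt) simp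
    hence l: "0 < l" by (simp add: l_def)
    have l2: "l * l = \<tau> * l + 1"
    proof -
      have "sqrt (\<tau>\<^sup>2 + 4) * sqrt (\<tau>\<^sup>2 + 4) = \<tau>\<^sup>2 + 4" by (rule real_sqrt_mult_self[THEN trans]) simp
      thus ?thesis unfolding l_def by (simp add: field_simps power2_eq_square)
    qed
    have eig: "A (A z + (l - \<tau>) *\<^sub>R z) = l *\<^sub>R (A z + (l - \<tau>) *\<^sub>R z)" for z
    proof -
      have "A (A z + (l - \<tau>) *\<^sub>R z) = l *\<^sub>R A z + z"
        by (simp only: linear_add[OF lin] linear_cmul[OF lin] ch) (simp add: algebra_simps)
      also have "\<dots> = l *\<^sub>R A z + (l * (l - \<tau>)) *\<^sub>R z" using l2 by (simp add: algebra_simps)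
      finally show ?thesis by (simp add: scaleR_add_right)
    qed
    show False
    proof (cases "\<forall>z. A z + (l - \<tau>) *\<^sub>R z = 0")
      case True
      have A: "A z = (\<tau> - l) *\<^sub>R z" for z
        using True[rule_format, of z] by (simp add: algebra_simps)
      have "cross (A 1) (A \<i>) = (\<tau> - l)\<^sup>2"
        unfolding A[of 1] A[of "\<i>"] by (simp add: cross_def power2_eq_square)
      moreover have "cross (A 1) (A \<i>) = D * cross 1 \<i>"
        unfolding D_def by (rule cross_complex_form) (rule form)
      ultimately have "D = (\<tau> - l)\<^sup>2" by (simp add: cross_def)
      thus False using D zero_le_power2[of "\<tau> - l"] by linarith
    next
      case False
      then obtain z where v: "A z + (l - \<tau>) *\<^sub>R z \<noteq> 0" by blast
      have "l ^ k *\<^sub>R (A z + (l - \<tau>) *\<^sub>R z) = 1 *\<^sub>R (A z + (l - \<tau>) *\<^sub>R z)"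
        using funpow_eigenvector[OF lin eig, of k z] by (simp add: Ak)
      hence "l ^ k = 1" using v unfolding scaleR_cancel_right by blast
      hence "l = 1" using power_eq_imp_eq_base[of l k 1] l k by simp
      hence "\<tau> = 0" using l2 by simp
      hence "A (A z) = z" for z using ch[of z] by simp
      hence "A ^^ 2 = id" by (simp add: fun_eq_iff numeral_2_eq_2)
      thus False using ord k by (auto simp: map_order_def)
    qed
  qed
  ultimately have "D > 0" by linarith
  thus ?thesis unfolding D_def by (simp add: power2_less_imp_less)
qed

text \<open>
  Up to the factor \<open>k\<close>, the average of the Euclidean inner product over the powers of \<open>A\<close>.
\<close>

definition orbit_inner :: "(complex \<Rightarrow> complex) \<Rightarrow> nat \<Rightarrow> complex \<Rightarrow> complex \<Rightarrow> real" where
  "orbit_inner A k x y = (\<Sum>j<k. inner ((A ^^ j) x) ((A ^^ j) y))"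

lemma funpow_linear:
  fixes A :: "'a::real_vector \<Rightarrow> 'a"
  shows "linear A \<Longrightarrow> linear (A ^^ n)"
  by (induction n) (auto intro: linear_compose simp: linear_id)

lemma orbit_inner_bilinear:
  assumes "linear A"
  shows "orbit_inner A k (x + y) z = orbit_inner A k x z + orbit_inner A k y z"
    and "orbit_inner A k (x - y) z = orbit_inner A k x z - orbit_inner A k y z"
    and "orbit_inner A k (r *\<^sub>R x) z = r * orbit_inner A k x z"
    and "orbit_inner A k z (x + y) = orbit_inner A k z x + orbit_inner A k z y"
    and "orbit_inner A k z (x - y) = orbit_inner A k z x - orbit_inner A k z y"
    and "orbit_inner A k z (r *\<^sub>R x) = r * orbit_inner A k z x"
  using funpow_linear[OF assms]
  by (simp_all add: orbit_inner_def linear_add linear_diff linear_cmul inner_add inner_diff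
      sum.distrib sum_subtractf sum_distrib_left)

lemma orbit_inner_commute: "orbit_inner A k x y = orbit_inner A k y x"
  by (simp add: orbit_inner_def inner_commute)

lemma orbit_inner_invariant:
  assumes "A ^^ k = id"
  shows "orbit_inner A k ((A ^^ n) x) ((A ^^ n) y) = orbit_inner A k x y"
proof (induction n)
  case (Suc n)
  have "orbit_inner A k (A u) (A v) = orbit_inner A k u v" for u v
  proof -
    define g where "g = (\<lambda>j. inner ((A ^^ j) u) ((A ^^ j) v))"
    have "orbit_inner A k (A u) (A v) = (\<Sum>j<k. g (Suc j))"
      by (simp add: orbit_inner_def g_def funpow_swap1)
    also have "\<dots> = (\<Sum>j<Suc k. g j) - g 0" by (subst sum.lessThan_Suc_shift) simp
    also have "\<dots> = (\<Sum>j<k. g j)" using assms by (simp add: g_def)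
    finally show ?thesis by (simp add: orbit_inner_def g_def)
  qed
  thus ?case using Suc by simp
qed simp

section \<open>Linear symmetries of the body\<close>

locale symmetric_oval = oval +
  fixes A :: "complex \<Rightarrow> complex" and k :: nat and \<alpha> \<beta> :: complex
  assumes form: "A z = \<alpha> * z + \<beta> * cnj z" and det_pos: "cmod \<beta> < cmod \<alpha>"
    and A_range_P: "A ` P ` (- {0}) = P ` (- {0})"
    and order_A: "map_order A k"
begin

lemma k_pos: "0 < k" and A_funpow_k: "A ^^ k = id"
  using order_A by (auto simp: map_order_def)

lemma linear_A: "linear A"
  by (rule linearI) (simp_all add: form algebra_simps scaleR_conv_of_real)

lemma alpha_nz: "\<alpha> \<noteq> 0" using det_pos by auto

lemma A_nz [simp]: "z \<noteq> 0 \<Longrightarrow> A z \<noteq> 0"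
proof
  assume "z \<noteq> 0" "A z = 0"
  hence "cmod (\<alpha> * z) = cmod (\<beta> * cnj z)" by (simp add: form add_eq_0_iff2)
  thus False using \<open>z \<noteq> 0\<close> det_pos by (simp add: norm_mult)
qed

lemma sgn_cross_A: "0 < cross (A x) (A y) \<longleftrightarrow> 0 < cross x y"
proof -
  have "0 < (cmod \<alpha>)\<^sup>2 - (cmod \<beta>)\<^sup>2" using det_pos by (simp add: power_strict_mono)
  thus ?thesis by (simp add: cross_complex_form[of A, OF form] zero_less_mult_iff)
qed

text \<open>
  \<open>A\<close> preserves orientation and the boundary, so it carries supporting lines to supporting
  lines.
\<close>

lemma A_P: assumes "v \<noteq> 0" shows "A (P v) = P (A v)"
proof -
  have "P (A v) \<in> A ` P ` (- {0})" unfolding A_range_P using assms by auto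
  then obtain u where u: "u \<noteq> 0" "P (A v) = A (P u)" by auto
  have "A (P v) \<in> P ` (- {0})" using A_range_P assms by blast
  moreover have "P ` (- {0}) \<subseteq> K" using P_in by auto
  ultimately have in_K: "A (P v) \<in> K" by blast
  show ?thesis
  proof (rule ccontr)
    assume ne: "A (P v) \<noteq> P (A v)"
    hence "P u \<noteq> P v" using u by auto
    hence "0 < cross v (P u - P v)" using strict_support P_in assms u by auto
    hence "0 < cross (A v) (A (P u) - A (P v))"
      by (simp add: sgn_cross_A flip: linear_diff[OF linear_A])
    moreover have "0 < cross (A v) (A (P v) - P (A v))"
      using strict_support[OF _ in_K ne] assms by simp
    ultimately show False by (simp add: u(2) cross_diff_right)
  qed
qed

lemma bounce_A: assumes "w \<noteq> 0" shows "bounce (A w) = A (bounce w)"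
proof -
  have "pole (A (bounce w)) = A (P (bounce w) - bounce w)"
    using assms by (simp add: pole_def A_P linear_diff[OF linear_A])
  also have "\<dots> = P (A w) + A w"
    using assms by (simp add: pole_bounce A_P linear_add[OF linear_A])
  finally have "unpole (pole (A (bounce w))) = bounce (A w)" by (simp add: bounce_def)
  thus ?thesis using assms by simp
qed

text \<open>
  A lift of \<open>A\<close> along \<open>exp\<close>: from \<open>A w = \<alpha> w (1 + (\<beta> / \<alpha>) cnj w / w)\<close>, where the last factor has
  positive real part as \<open>\<bar>\<beta>\<bar> < \<bar>\<alpha>\<bar>\<close>.
\<close>

definition sym_lift :: "complex \<Rightarrow> complex" where
  "sym_lift z = z + Ln \<alpha> + Ln (1 + \<beta> / \<alpha> * exp (cnj z - z))"

lemma sym_lift_arg: "0 < Re (1 + \<beta> / \<alpha> * exp (cnj z - z))"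
proof -
  have "\<bar>Re (\<beta> / \<alpha> * exp (cnj z - z))\<bar> \<le> cmod (\<beta> / \<alpha> * exp (cnj z - z))"
    by (rule abs_Re_le_cmod)
  also have "\<dots> = cmod \<beta> / cmod \<alpha>" by (simp add: norm_mult norm_divide)
  also have "\<dots> < 1" using det_pos by (simp add: divide_less_eq)
  finally show ?thesis by simp
qed

lemma exp_sym_lift: "exp (sym_lift z) = A (exp z)"
proof -
  have "1 + \<beta> / \<alpha> * exp (cnj z - z) \<noteq> 0"
    using sym_lift_arg[of z] by (metis less_irrefl zero_complex.simps(1))
  thus ?thesis
    using alpha_nz by (simp add: sym_lift_def exp_add form exp_diff exp_cnj field_simps)
qed

lemma continuous_sym_lift: "continuous_on S sym_lift"
  unfolding sym_lift_def
proof (intro continuous_intros)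
  fix z show "1 + \<beta> / \<alpha> * exp (cnj z - z) \<notin> \<real>\<^sub>\<le>\<^sub>0"
    using sym_lift_arg[of z] by (auto simp: complex_nonpos_Reals_iff)
qed

lemma sym_lift_turn: "sym_lift (z + turn j) = sym_lift z + turn j"
proof -
  have "cnj (z + turn j) - (z + turn j) = cnj z - z + turn (-2 * j)"
    by (simp add: complex_eq_iff)
  thus ?thesis unfolding sym_lift_def by (simp only: exp_add exp_turn) simp
qed

lemma sym_lift_half_turn: "sym_lift (z + \<i> * pi) = sym_lift z + \<i> * pi"
proof -
  have "cnj (z + \<i> * pi) - (z + \<i> * pi) = cnj z - z + turn (-1)"
    by (simp add: complex_eq_iff)
  thus ?thesis unfolding sym_lift_def by (simp only: exp_add exp_turn) simp
qed

text \<open>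
  The lift displaces the angle by a constant up to an error below \<open>\<pi> / 2\<close>, which settles angles
  that differ by \<open>\<pi>\<close> or more. For smaller differences, the sine of the difference keeps its sign
  because \<open>A\<close> preserves orientation.
\<close>

lemma sym_lift_mono:
  assumes "Im x < Im y" shows "Im (sym_lift x) < Im (sym_lift y)"
proof -
  define \<delta> where "\<delta> = (\<lambda>z. Im (Ln (1 + \<beta> / \<alpha> * exp (cnj z - z))))"
  have \<delta>: "\<bar>\<delta> z\<bar> < pi / 2" for z
    unfolding \<delta>_def by (rule Re_Ln_pos_lt_imp[OF sym_lift_arg])
  have Im: "Im (sym_lift z) = Im z + Im (Ln \<alpha>) + \<delta> z" for z by (simp add: sym_lift_def \<delta>_def)
  show ?thesis
  proof (cases "Im y - Im x < pi")
    case True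
    hence "0 < cross (exp x) (exp y)" using assms by (simp add: cross_exp sin_gt_zero)
    hence "0 < cross (exp (sym_lift x)) (exp (sym_lift y))"
      by (simp add: exp_sym_lift sgn_cross_A)
    hence pos: "0 < sin (Im (sym_lift y) - Im (sym_lift x))"
      by (simp add: cross_exp zero_less_mult_iff)
    show ?thesis
    proof (rule ccontr)
      assume "\<not> ?thesis"
      moreover have "Im (sym_lift x) - Im (sym_lift y) < pi"
        using \<delta>[of x] \<delta>[of y] assms unfolding Im by linarith
      ultimately have "0 \<le> sin (Im (sym_lift x) - Im (sym_lift y))" by (intro sin_ge_zero) auto
      thus False using pos sin_minus[of "Im (sym_lift y) - Im (sym_lift x)"] by simp
    qed
  next
    case False
    thus ?thesis using \<delta>[of x] \<delta>[of y] unfolding Im by linarith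
  qed
qed

text \<open>
  Both sides lift the same map, so they differ by full turns; both advance the angle of \<open>sym_lift z\<close>
  by an amount between \<open>0\<close> and \<open>\<pi>\<close>, so there are none.
\<close>

lemma sym_lift_commute: "lift (sym_lift z) = sym_lift (lift z)"
proof -
  have "exp (lift (sym_lift z) - sym_lift (lift z)) = 1"
    by (simp add: exp_diff exp_lift exp_sym_lift bounce_A)
  then obtain j where j: "lift (sym_lift z) - sym_lift (lift z) = turn j"
    using exp_eq_1_turn by blast
  have "Im (sym_lift z) < Im (sym_lift (lift z))" by (rule sym_lift_mono[OF Im_lift(1)])
  moreover have "Im (sym_lift (lift z)) < Im (sym_lift (z + \<i> * pi))"
    by (rule sym_lift_mono) (simp add: Im_lift)
  ultimately have "\<bar>Im (lift (sym_lift z) - sym_lift (lift z))\<bar> < pi"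
    using Im_lift[of "sym_lift z"] unfolding sym_lift_half_turn by (simp add: abs_less_iff)
  hence "pi * (2 * \<bar>real_of_int j\<bar>) < pi * 1" unfolding j by (simp add: abs_mult)
  hence "j = 0" unfolding mult_less_cancel_left_pos[OF pi_gt_zero] by linarith
  thus ?thesis using j by simp
qed

lemma exp_sym_lift_funpow: "exp ((sym_lift ^^ i) z) = (A ^^ i) (exp z)"
  by (induction i) (auto simp: exp_sym_lift)

lemma sym_lift_funpow_turn: "(sym_lift ^^ i) (z + turn j) = (sym_lift ^^ i) z + turn j"
  by (induction i) (auto simp: sym_lift_turn)

lemma sym_lift_funpow_mono: "Im x < Im y \<Longrightarrow> Im ((sym_lift ^^ i) x) < Im ((sym_lift ^^ i) y)"
  by (induction i) (auto intro: sym_lift_mono)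

lemma sym_lift_funpow_commute: "lift ((sym_lift ^^ i) z) = (sym_lift ^^ i) (lift z)"
  by (induction i) (auto simp: sym_lift_commute)

lemma continuous_sym_lift_funpow: "continuous_on S (sym_lift ^^ i)"
proof (induction i)
  case (Suc i) thus ?case
    by (auto intro: continuous_on_compose2[OF continuous_sym_lift[of UNIV]])
qed (simp add: id_def)

lemma translate_funpow: "((\<lambda>z. z + turn j) ^^ n) z = z + turn (int n * j)"
  by (induction n) (auto simp: algebra_simps turn_add)

lemma sym_lift_rotation:
  obtains m where "\<And>z. (sym_lift ^^ k) z = z + turn m"
proof -
  obtain m where "\<And>z. z \<in> UNIV \<Longrightarrow> (sym_lift ^^ k) z - z = turn m"
    by (rule exp_eq_1_constant[of UNIV "\<lambda>z. (sym_lift ^^ k) z - z"])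
       (auto simp: exp_diff exp_sym_lift_funpow A_funpow_k intro!: continuous_intros continuous_sym_lift_funpow)
  thus ?thesis using that by (simp add: algebra_simps)
qed

text \<open>
  Let \<open>d\<close> divide \<open>m\<close> and \<open>k\<close>. The lift of the power \<open>A\<^sup>k\<^sup>/\<^sup>d\<close> has the same \<open>d\<close>-th iterate as the rotation
  by \<open>m / d\<close> full turns, hence changes every angle by \<open>m / d\<close> full turns. So this power maps
  every vector to a positive multiple, and having finite order it is the identity.
\<close>

lemma rotation_primitive:
  assumes m: "\<And>z. (sym_lift ^^ k) z = z + turn m" shows "coprime m (int k)"
proof -
  define d where "d = nat (gcd m (int k))"
  have gpos: "0 < gcd m (int k)" using k_pos by simp
  hence d0: "0 < d" and d: "int d = gcd m (int k)" by (simp_all add: d_def)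
  obtain m' where m': "m = int d * m'" using gcd_dvd1[of m "int k"] unfolding d by blast
  have "d dvd k" using gcd_dvd2[of m "int k"] unfolding d[symmetric] by simp
  then obtain k' where k': "k = d * k'" by blast
  have "A ^^ k' = id"
  proof
    fix x
    have exp_case: "(A ^^ k') (exp z) = exp z" for z
    proof -
      let ?f = "sym_lift ^^ k'" and ?g = "\<lambda>z. z + turn m'"
      have f: "(?f ^^ d) z = z + turn m" by (simp add: funpow_mult m mult.commute[of k'] flip: k')
      have g: "(?g ^^ d) z = z + turn m" by (simp add: translate_funpow m')
      have "Im (?f z) = Im (?g z)"
        by (rule commuting_increasing_maps_eq[where S = UNIV and \<theta> = Im and k = d])
           (auto simp: f g d0 sym_lift_funpow_turn sym_lift_funpow_mono)
      hence "exp (?f z) = exp (Re (?f z) - Re (?g z)) *\<^sub>R exp (?g z)"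
        by (intro exp_same_Im) simp
      hence "\<exists>c>0. (A ^^ k') (exp z) = c *\<^sub>R exp z"
        unfolding exp_sym_lift_funpow by (auto simp: exp_add intro!: exI)
      then obtain c where c: "0 < c" "(A ^^ k') (exp z) = c *\<^sub>R exp z" by blast
      have "((A ^^ k') ^^ d) (exp z) = c ^ d *\<^sub>R exp z"
        by (rule funpow_eigenvector[OF funpow_linear[OF linear_A] c(2)])
      moreover have "(A ^^ k') ^^ d = id" by (simp add: funpow_mult A_funpow_k mult.commute[of k'] flip: k')
      ultimately have "(c ^ d - 1) *\<^sub>R exp z = 0" by (simp add: algebra_simps)
      hence "c ^ d = 1" by simp
      hence "c = 1" using power_eq_imp_eq_base[of c d 1] c d0 by simp
      thus ?thesis using c by simp
    qed
    show "(A ^^ k') x = id x"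
    proof (cases "x = 0")
      case True thus ?thesis using linear_0[OF funpow_linear[OF linear_A]] by simp
    next
      case False thus ?thesis using exp_case[of "Ln x"] by simp
    qed
  qed
  moreover have "0 < k'" using k' k_pos by (cases k') auto
  ultimately have "\<not> k' < k" using order_A by (auto simp: map_order_def)
  hence "d = 1" using k' d0 \<open>0 < k'\<close> by (cases "d = 1") auto
  thus ?thesis using d by (simp add: coprime_iff_gcd_eq_1)
qed

text \<open>
  From here on, \<open>Z\<close> is the lift of an essential closed curve all of whose points are periodic with
  rotation number \<open>r / k\<close>.
\<close>

context
  fixes Z :: "real \<Rightarrow> complex" and n r :: int
  assumes k2: "2 \<le> k" and cont_Z: "continuous_on UNIV Z"
    and step_Z: "\<forall>s. Z (s + 1) = Z s + turn n" and n_pos: "0 < n"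
    and periodic_Z: "\<forall>s. Z s \<in> periodic_lifts k r"
begin

text \<open>
  On the set of periodic lifts, \<open>lift\<close> and a suitable lift of a power of \<open>A\<close> are commuting increasing
  maps with the same \<open>k\<close>-th iterate.
\<close>

lemma bounce_eq_power_of_symmetry:
  assumes z: "z \<in> periodic_lifts k r"
  obtains s where "bounce (exp z) = (A ^^ s) (exp z)"
proof -
  obtain m where m: "\<And>z. (sym_lift ^^ k) z = z + turn m" using sym_lift_rotation by blast
  \<comment> \<open>Choose the power \<open>s\<close> of \<open>A\<close> and the number \<open>j\<close> of additional turns such that the \<open>k\<close>-th iterate
    of the composite \<open>g\<close> below is a rotation by \<open>m s + j k = r\<close> full turns.\<close>
  obtain u v where "u * m + v * int k = 1"
    using bezout_int[of m "int k"] rotation_primitive[OF m] by (auto simp: coprime_iff_gcd_eq_1)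
  hence uv: "r = (u * r) * m + (v * r) * int k"
    by (metis distrib_right mult.assoc mult.commute mult.right_neutral)
  define s where "s = nat ((u * r) mod int k)"
  define j where "j = (u * r) div int k * m + v * r"
  have "u * r = (u * r) div int k * int k + int s" using k_pos by (simp add: s_def)
  hence "r = ((u * r) div int k * int k + int s) * m + (v * r) * int k" using uv by simp
  hence j: "r = m * int s + j * int k" unfolding j_def by (simp add: algebra_simps)
  define g where "g = (\<lambda>z. (sym_lift ^^ s) z + turn j)"
  let ?S = "periodic_lifts k r"
  note total = periodic_lifts_total_order[OF k_pos cont_Z step_Z n_pos periodic_Z]
  have lift_S: "lift x \<in> ?S" if "x \<in> ?S" for x
  proof -
    have "(lift ^^ k) (lift x) = lift ((lift ^^ k) x)" by (simp add: funpow_swap1)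
    thus ?thesis using that by (simp add: periodic_lifts_def lift_turn)
  qed
  have g_lift: "lift (g x) = g (lift x)" for x
    by (simp add: g_def lift_turn sym_lift_funpow_commute)
  have g_lift': "(lift ^^ i) (g x) = g ((lift ^^ i) x)" for i x
    by (induction i) (simp_all add: g_lift)
  have g_turn: "g (x + turn i) = g x + turn i" for i x
    by (simp add: g_def sym_lift_funpow_turn)
  have g_S: "g x \<in> ?S" if "x \<in> ?S" for x
    using that by (simp add: periodic_lifts_def g_lift' g_turn)
  have "(g ^^ i) x = (sym_lift ^^ (s * i)) x + turn (int i * j)" for i x
  proof (induction i)
    case (Suc i)
    have "(g ^^ Suc i) x = g ((sym_lift ^^ (s * i)) x + turn (int i * j))" by (simp add: Suc)
    also have "\<dots> = (sym_lift ^^ s) ((sym_lift ^^ (s * i)) x) + turn (int i * j) + turn j"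
      by (simp add: g_turn) (simp add: g_def)
    also have "\<dots> = (sym_lift ^^ (s + s * i)) x + turn (int (Suc i) * j)"
      by (simp add: funpow_add algebra_simps turn_add)
    finally show ?case by simp
  qed simp
  from this[of k] have "(g ^^ k) z = ((sym_lift ^^ k) ^^ s) z + turn (int k * j)"
    by (simp add: funpow_mult mult.commute)
  also have "(sym_lift ^^ k) = (\<lambda>z. z + turn m)" using m by auto
  finally have "(g ^^ k) z = z + turn r"
    by (simp add: translate_funpow j turn_add algebra_simps)
  hence eq: "Im ((lift ^^ k) z) = Im ((g ^^ k) z)" using z by (simp add: periodic_lifts_def)
  have Im_eq: "Im (lift z) = Im (g z)"
  proof (rule commuting_increasing_maps_eq[where f = lift and g = g and x = z and S = ?S and \<theta> = Im and k = k])
    fix x y assume xy: "x \<in> ?S" "y \<in> ?S" and less: "Im x < Im y"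
    have "\<not> (\<forall>i<k. Im ((lift ^^ i) y) < Im ((lift ^^ i) x))"
      using less k_pos by (auto intro!: exI[of _ 0])
    moreover have "x \<noteq> y" using less by auto
    ultimately have "\<forall>i<k. Im ((lift ^^ i) x) < Im ((lift ^^ i) y)"
      using total[OF xy] by blast
    from this[rule_format, of 1] show "Im (lift x) < Im (lift y)" using k2 by simp
    show "Im (g x) < Im (g y)" using less by (simp add: g_def sym_lift_funpow_mono)
  qed (use lift_S g_S g_lift z k_pos eq in auto)
  have "lift z = g z"
    using total[OF lift_S[OF z] g_S[OF z]] Im_eq k_pos by (auto dest!: spec[of _ 0])
  hence "exp (lift z) = exp (g z)" by simp
  hence "bounce (exp z) = (A ^^ s) (exp z)"
    by (simp add: exp_lift g_def exp_add exp_sym_lift_funpow)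
  thus ?thesis using that by blast
qed

text \<open>
  Some power of \<open>A\<close> carries \<open>P w - w\<close> to \<open>P w + w\<close>, so their \<open>A\<close>-invariant norms agree,
  and the difference of the squared norms is four times \<open>orbit_inner A k (P w) w\<close>. The drift of the angle along
  \<open>Z\<close> makes every direction occur.
\<close>

lemma tangent_conjugate_to_position:
  assumes "v \<noteq> 0" shows "orbit_inner A k (P v) v = 0"
proof -
  define D where "D = (\<lambda>s. Im (Z s) - Arg v)"
  have cont: "continuous_on UNIV D" unfolding D_def by (intro continuous_intros cont_Z)
  have step: "\<forall>s. D (s + 1) = D s + 2 * pi * of_int n" using step_Z by (simp add: D_def)
  have pos: "0 < 2 * pi * real_of_int n" using n_pos by simp
  obtain a where a: "D a \<le> 0" using drift_ex_nonpos[OF cont step pos] by blast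
  obtain b where b: "\<And>s. b \<le> s \<Longrightarrow> 0 < D s" using drift_eventually_pos[OF cont step pos] by blast
  have "\<exists>s\<ge>a. s \<le> max a b \<and> D s = 0"
    using a b[of "max a b"] by (intro IVT' continuous_on_subset[OF cont]) auto
  then obtain s where "D s = 0" by blast
  hence Im_Z: "Im (Z s) = Arg v" by (simp add: D_def)
  define w where "w = exp (Z s)"
  define c where "c = cmod v / exp (Re (Z s))"
  have w: "w \<noteq> 0" and c: "0 < c" using assms by (simp_all add: w_def c_def)
  have "v = cmod v *\<^sub>R cis (Arg v)"
    by (simp add: scaleR_conv_of_real rcis_cmod_Arg flip: rcis_def)
  also have "\<dots> = c *\<^sub>R w"
    by (auto simp: c_def w_def complex_eq_iff Re_exp Im_exp Im_Z)
  finally have v: "v = c *\<^sub>R w" .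
  obtain i where i: "bounce w = (A ^^ i) w"
    using bounce_eq_power_of_symmetry[of "Z s"] periodic_Z unfolding w_def by blast
  have AP: "(A ^^ j) (P w) = P ((A ^^ j) w) \<and> (A ^^ j) w \<noteq> 0" for j
    by (induction j) (use w A_P in auto)
  have "(A ^^ i) (P w - w) = P w + w"
    using AP[of i] pole_bounce[OF w] i by (simp add: linear_diff[OF funpow_linear[OF linear_A]])
  hence "orbit_inner A k (P w + w) (P w + w) = orbit_inner A k (P w - w) (P w - w)"
    using orbit_inner_invariant[OF A_funpow_k, of i "P w - w" "P w - w"] by simp
  hence "orbit_inner A k (P w) w = 0"
    by (simp add: orbit_inner_bilinear[OF linear_A] orbit_inner_commute[of A k w "P w"])
  thus ?thesis unfolding v P_scale[OF c w] by (simp add: orbit_inner_bilinear[OF linear_A])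
qed

end

end

section \<open>The body bounded by a strictly convex curve\<close>

lemma cross_conv_inner: "cross v z = inner (\<i> * v) z"
  by (simp add: cross_def inner_complex_def)

lemma cross_derivative_eq_0_of_min:
  assumes "(\<gamma> has_vector_derivative d) (at t)" "\<And>s. cross v (\<gamma> t) \<le> cross v (\<gamma> s)"
  shows "cross v d = 0"
proof -
  have "((\<lambda>s. cross v (\<gamma> s)) has_real_derivative cross v d) (at t)"
    unfolding cross_conv_inner has_real_derivative_iff_has_vector_derivative
    by (rule bounded_linear.has_vector_derivative[OF bounded_linear_inner_right assms(1)])
  thus ?thesis by (rule DERIV_local_min[where d = 1]) (use assms(2) in auto)
qed

lemma has_vector_derivative_affine_compose:
  assumes "(f has_vector_derivative d) (at (a * s + b))"
  shows "((\<lambda>s. f (a * s + b)) has_vector_derivative a *\<^sub>R d) (at s)"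
proof -
  have "((\<lambda>s. a * s + b) has_vector_derivative a) (at s)"
    unfolding has_real_derivative_iff_has_vector_derivative[symmetric]
    by (auto intro!: derivative_eq_intros)
  thus ?thesis using vector_diff_chain_at assms unfolding comp_def by blast
qed

locale convex_curve =
  fixes L :: real and \<gamma> :: "real \<Rightarrow> complex"
  assumes regular: "regular_closed_curve L \<gamma>"
    and C1: "\<gamma> C1_differentiable_on UNIV"
    and oriented: "positively_oriented L \<gamma>"
    and strictly_convex: "strictly_convex_curve \<gamma>"
begin

definition K where "K = range \<gamma> \<union> inside (range \<gamma>)"

lemma L_pos: "0 < L" and periodic: "\<gamma> (t + L) = \<gamma> t" and inj: "inj_on \<gamma> {0..<L}"
  and velocity_nz: "velocity \<gamma> t \<noteq> 0"
  using regular by (auto simp: regular_closed_curve_def)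

lemma has_velocity: "(\<gamma> has_vector_derivative velocity \<gamma> t) (at t)"
  using C1 by (simp add: C1_differentiable_on_eq vector_derivative_works)

lemma continuous_velocity: "continuous_on S (velocity \<gamma>)"
  using C1 by (auto simp: C1_differentiable_on_eq intro: continuous_on_subset)

lemma continuous_curve: "continuous_on S \<gamma>"
  by (rule continuous_on_vector_derivative) (rule has_vector_derivative_at_within[OF has_velocity])

lemma periodic_int: "\<gamma> (t + of_int n * L) = \<gamma> t"
proof -
  have nat: "\<gamma> (t + real n * L) = \<gamma> t" for n t
  proof (induction n)
    case (Suc n)
    have "\<gamma> (t + real (Suc n) * L) = \<gamma> ((t + real n * L) + L)" by (simp add: algebra_simps)
    thus ?case using periodic Suc by simp
  qed simp
  show ?thesis
  proof (cases n)
    case (nonneg m) thus ?thesis using nat[of t m] by simp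
  next
    case (neg m)
    hence "real_of_int n = - real (Suc m)" by simp
    hence "of_int n * L = - (real (Suc m) * L)" by (simp only: minus_mult_left)
    hence "t + of_int n * L + real (Suc m) * L = t" by linarith
    thus ?thesis using nat[of "t + of_int n * L" "Suc m"] by metis
  qed
qed

lemma velocity_periodic_int: "velocity \<gamma> (t + of_int n * L) = velocity \<gamma> t"
proof (rule vector_derivative_at)
  have "((\<lambda>s. \<gamma> (s - of_int n * L)) has_vector_derivative velocity \<gamma> t) (at (t + of_int n * L))"
    using has_vector_derivative_affine_compose[of \<gamma> "velocity \<gamma> t" 1 "t + of_int n * L" "- of_int n * L"]
      has_velocity[of t] by simp
  moreover have "\<gamma> (s - of_int n * L) = \<gamma> s" for s using periodic_int[of s "- n"] by simp
  ultimately show "(\<gamma> has_vector_derivative velocity \<gamma> t) (at (t + of_int n * L))" by simp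
qed

lemma reduce_parameter: obtains n :: int where "0 \<le> t + of_int n * L" "t + of_int n * L < L"
proof
  have "t / L * L = t" using L_pos by simp
  thus "0 \<le> t + of_int (- \<lfloor>t / L\<rfloor>) * L" "t + of_int (- \<lfloor>t / L\<rfloor>) * L < L"
    using L_pos floor_divide_lower[OF L_pos, of t] floor_divide_upper[OF L_pos, of t]
    by (auto simp: algebra_simps)
qed

lemma same_point:
  assumes "\<gamma> s = \<gamma> t" obtains n :: int where "t = s + of_int n * L"
proof -
  obtain m :: int where m: "0 \<le> s + of_int m * L" "s + of_int m * L < L"
    by (rule reduce_parameter)
  obtain n :: int where n: "0 \<le> t + of_int n * L" "t + of_int n * L < L"
    by (rule reduce_parameter)
  have "s + of_int m * L = t + of_int n * L"
    by (rule inj_onD[OF inj]) (use m n assms in \<open>auto simp: periodic_int\<close>)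
  hence "t = s + of_int (m - n) * L" by (simp add: algebra_simps)
  thus ?thesis using that by blast
qed

definition loop :: "real \<Rightarrow> complex" where "loop s = \<gamma> (L * s)"

lemma has_loop_velocity: "(loop has_vector_derivative L *\<^sub>R velocity \<gamma> (L * s)) (at s)"
  using has_vector_derivative_affine_compose[of \<gamma> "velocity \<gamma> (L * s)" L s 0] has_velocity
  unfolding loop_def[abs_def] by simp

lemma range_eq: "range \<gamma> = \<gamma> ` {0..<L}"
proof
  show "range \<gamma> \<subseteq> \<gamma> ` {0..<L}"
  proof clarify
    fix t
    obtain n :: int where "0 \<le> t + of_int n * L" "t + of_int n * L < L" by (rule reduce_parameter)
    thus "\<gamma> t \<in> \<gamma> ` {0..<L}"
      by (intro image_eqI[of _ _ "t + of_int n * L"]) (auto simp: periodic_int)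
  qed
qed auto

lemma path_image_loop: "path_image loop = range \<gamma>"
proof
  show "range \<gamma> \<subseteq> path_image loop"
    unfolding range_eq path_image_def loop_def
  proof clarify
    fix t assume "t \<in> {0..<L}"
    thus "\<gamma> t \<in> (\<lambda>s. \<gamma> (L * s)) ` {0..1}"
      using L_pos by (intro image_eqI[of _ _ "t / L"]) auto
  qed
qed (auto simp: path_image_def loop_def)

lemma simple_loop: "simple_path loop" "pathfinish loop = pathstart loop"
proof -
  show "pathfinish loop = pathstart loop"
    using periodic[of 0] by (simp add: pathfinish_def pathstart_def loop_def)
  have "path loop" unfolding path_def loop_def
    by (rule continuous_on_compose2[OF continuous_curve[of UNIV]]) (auto intro!: continuous_intros)
  moreover have "loop_free loop" unfolding loop_free_def
  proof (intro ballI impI)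
    fix x y :: real assume xy: "x \<in> {0..1}" "y \<in> {0..1}" and "loop x = loop y"
    then obtain n :: int where "L * y = L * x + of_int n * L"
      unfolding loop_def using same_point by blast
    hence "L * (y - x - of_int n) = 0" by (simp add: algebra_simps)
    hence n: "y - x = of_int n" using L_pos by simp
    have "-1 \<le> real_of_int n" "real_of_int n \<le> 1" using xy by (auto simp flip: n)
    hence "n = -1 \<or> n = 0 \<or> n = 1" by linarith
    thus "x = y \<or> x = 0 \<and> y = 1 \<or> x = 1 \<and> y = 0" using n xy by auto
  qed
  ultimately show "simple_path loop" by (simp add: simple_path_def)
qed

lemma K_eq: "K = - exterior \<gamma>"
  by (simp add: K_def union_with_inside)

lemma compact_range: "compact (range \<gamma>)"
  using simple_loop(1) unfolding path_image_loop[symmetric] by (rule compact_simple_path_image)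

lemma compact_K: "compact K"
proof -
  have "closed K" unfolding K_eq 
    by (rule closed_Compl[OF open_outside[OF compact_imp_closed[OF compact_range]]])
  moreover have "bounded K" unfolding K_def
    using compact_range by (simp add: bounded_inside compact_imp_bounded)
  ultimately show ?thesis by (simp add: compact_eq_bounded_closed)
qed

lemma K_strictly_convex: "\<lbrakk>x \<in> K; y \<in> K; x \<noteq> y\<rbrakk> \<Longrightarrow> open_segment x y \<subseteq> interior K"
  using strictly_convex
  unfolding strictly_convex_curve_def strictly_convex_set_def K_def[symmetric] by blast

lemma convex_K: "convex K"
  unfolding convex_contains_open_segment
proof (intro ballI)
  fix x y assume "x \<in> K" "y \<in> K"
  thus "open_segment x y \<subseteq> K"
    using K_strictly_convex[of x y] interior_subset[of K] by (cases "x = y") auto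
qed

lemma curve_in_K: "\<gamma> t \<in> K" by (simp add: K_def)

lemma curve_notin_interior: "\<gamma> t \<notin> interior K"
proof -
  have "\<gamma> t \<in> frontier (outside (range \<gamma>))"
    using Jordan_inside_outside[OF simple_loop] unfolding path_image_loop by auto
  thus ?thesis unfolding K_eq by (simp add: frontier_def interior_closure)
qed

lemma inside_nonempty: "inside (range \<gamma>) \<noteq> {}"
  using Jordan_inside_outside[OF simple_loop] unfolding path_image_loop by blast

lemma interior_K_nonempty: "interior K \<noteq> {}"
proof -
  have "open (inside (range \<gamma>))"
    using Jordan_inside_outside[OF simple_loop] unfolding path_image_loop by blast
  hence "inside (range \<gamma>) \<subseteq> interior K" by (intro interior_maximal) (auto simp: K_def)
  thus ?thesis using inside_nonempty by blast
qed

text \<open>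
  A supporting line at a boundary point is tangent by Fermat's criterion. It meets the body
  only there, because the midpoint to a second contact would be an interior point on the line.
\<close>

lemma supporting_line:
  obtains r where "r \<noteq> 0" "\<And>z. \<lbrakk>z \<in> K; z \<noteq> \<gamma> t\<rbrakk> \<Longrightarrow> 0 < cross (r *\<^sub>R velocity \<gamma> t) (z - \<gamma> t)"
proof -
  have rel: "rel_interior K = interior K" by (rule rel_interior_nonempty_interior[OF interior_K_nonempty])
  obtain a where a: "a \<noteq> 0" "\<And>y. y \<in> K \<Longrightarrow> inner a (\<gamma> t) \<le> inner a y"
      "\<And>y. y \<in> interior K \<Longrightarrow> inner a (\<gamma> t) < inner a y"
    using supporting_hyperplane_rel_boundary[OF convex_K curve_in_K[of t]] curve_notin_interior
    unfolding rel by metis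
  define v where "v = - \<i> * a"
  have iv: "\<i> * v = a" by (simp add: v_def)
  have v: "v \<noteq> 0" using a by (simp add: v_def)
  have "cross v (velocity \<gamma> t) = 0"
    by (rule cross_derivative_eq_0_of_min[OF has_velocity])
       (simp add: cross_conv_inner iv a(2) curve_in_K)
  then obtain q where q: "velocity \<gamma> t = q *\<^sub>R v" using cross_eq_0_imp[OF v] by blast
  hence "q \<noteq> 0" using velocity_nz[of t] by auto
  hence v_eq: "v = (1 / q) *\<^sub>R velocity \<gamma> t" using q by simp
  have "0 < cross v (z - \<gamma> t)" if z: "z \<in> K" "z \<noteq> \<gamma> t" for z
  proof -
    have "midpoint (\<gamma> t) z \<in> open_segment (\<gamma> t) z" using z by simp
    moreover have "open_segment (\<gamma> t) z \<subseteq> interior K"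
      using z by (intro K_strictly_convex curve_in_K) auto
    ultimately have "midpoint (\<gamma> t) z \<in> interior K" by blast
    from a(3)[OF this] have "inner a (\<gamma> t) < inner a z"
      by (simp add: midpoint_def inner_add_right)
    thus ?thesis by (simp add: cross_conv_inner iv inner_diff_right)
  qed
  thus ?thesis using that[of "1 / q"] \<open>q \<noteq> 0\<close> v_eq by simp
qed

text \<open>
  The sign of the area form cannot change along the curve. Were it negative, the reversed curve
  would have nonnegative winding number about \<open>z\<close>, whereas orientation gives \<open>-1\<close>.
\<close>

lemma positive_side:
  assumes z: "z \<in> inside (range \<gamma>)" shows "0 < cross (velocity \<gamma> t) (z - \<gamma> t)"
proof (rule ccontr)
  define f where "f = (\<lambda>t. cross (velocity \<gamma> t) (z - \<gamma> t))"
  have z': "z \<in> K" "z \<notin> range \<gamma>"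
    using z by (auto simp: K_def inside_def)
  have nz: "f s \<noteq> 0" for s
  proof -
    obtain r where r: "r \<noteq> 0"
      "\<And>z. \<lbrakk>z \<in> K; z \<noteq> \<gamma> s\<rbrakk> \<Longrightarrow> 0 < cross (r *\<^sub>R velocity \<gamma> s) (z - \<gamma> s)"
      using supporting_line[of s] by blast
    have "0 < cross (r *\<^sub>R velocity \<gamma> s) (z - \<gamma> s)" using z' by (intro r) auto
    thus ?thesis by (auto simp: f_def cross_scale_left)
  qed
  assume "\<not> ?thesis"
  hence t: "f t < 0" using nz[of t] by (auto simp: f_def)
  have "continuous_on UNIV f"
    unfolding f_def by (intro continuous_intros continuous_velocity continuous_curve)
  hence conn: "connected (range f)" by (rule connected_continuous_image) simp
  have neg: "f s < 0" for s
  proof (rule ccontr)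
    assume "\<not> f s < 0"
    hence "0 \<in> range f" using connectedD_interval[OF conn, of "f t" "f s" 0] t by auto
    thus False using nz by auto
  qed
  define rev where "rev = (\<lambda>s. loop (1 - s))"
  have rev_eq: "rev = reversepath loop" by (simp add: rev_def reversepath_def fun_eq_iff)
  have rev': "(rev has_vector_derivative - (L *\<^sub>R velocity \<gamma> (L * (1 - s)))) (at s)" for s
    using has_vector_derivative_affine_compose[of loop "L *\<^sub>R velocity \<gamma> (L * (1 - s))" "- 1" s 1]
      has_loop_velocity[of "1 - s"]
    unfolding rev_def by simp
  have "loop C1_differentiable_on {0..1}"
    unfolding C1_differentiable_on_def
    by (intro exI[of _ "\<lambda>s. L *\<^sub>R velocity \<gamma> (L * s)"] conjI ballI has_loop_velocity)
       (auto intro!: continuous_intros continuous_on_compose2[OF continuous_velocity[of UNIV]])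
  hence valid: "valid_path loop"
    unfolding valid_path_def by (rule C1_differentiable_imp_piecewise)
  have z_loop: "z \<notin> path_image loop" using z' path_image_loop by simp
  have "0 \<le> Re (winding_number rev z)"
  proof (rule winding_number_pos_le)
    show "valid_path rev" unfolding rev_eq using valid by simp
    show "z \<notin> path_image rev" unfolding rev_eq using z_loop by simp
    fix s
    have "vector_derivative rev (at s) = - (L *\<^sub>R velocity \<gamma> (L * (1 - s)))"
      by (rule vector_derivative_at[OF rev'])
    hence "Im (vector_derivative rev (at s) * cnj (rev s - z)) = - L * f (L * (1 - s))"
      by (simp add: rev_def loop_def f_def cross_def algebra_simps)
    also have "\<dots> \<ge> 0" using neg[of "L * (1 - s)"] L_pos by (simp add: mult_le_0_iff)
    finally show "0 \<le> Im (vector_derivative rev (at s) * cnj (rev s - z))" .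
  qed
  also have "winding_number rev z = - winding_number loop z"
    unfolding rev_eq using valid_path_imp_path[OF valid] z_loop by (rule winding_number_reversepath)
  also have "winding_number loop z = 1"
    using oriented z unfolding positively_oriented_def loop_def[abs_def] by blast
  finally show False by simp
qed

lemma tangent_support: "\<lbrakk>z \<in> K; z \<noteq> \<gamma> t\<rbrakk> \<Longrightarrow> 0 < cross (velocity \<gamma> t) (z - \<gamma> t)"
proof -
  assume z: "z \<in> K" "z \<noteq> \<gamma> t"
  obtain r where "r \<noteq> 0"
    and r: "\<And>z. \<lbrakk>z \<in> K; z \<noteq> \<gamma> t\<rbrakk> \<Longrightarrow> 0 < cross (r *\<^sub>R velocity \<gamma> t) (z - \<gamma> t)"
    using supporting_line[of t] by blast
  note r = r[unfolded cross_scale_left]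
  obtain z0 where z0: "z0 \<in> inside (range \<gamma>)" using inside_nonempty by blast
  hence "z0 \<in> K" "z0 \<noteq> \<gamma> t" by (auto simp: K_def inside_def)
  hence "0 < r * cross (velocity \<gamma> t) (z0 - \<gamma> t)" by (rule r)
  hence "0 < r" using positive_side[OF z0, of t] by (simp add: zero_less_mult_iff)
  thus "0 < cross (velocity \<gamma> t) (z - \<gamma> t)" using r[OF z] by (simp add: zero_less_mult_iff)
qed

text \<open>
  For \<open>v \<noteq> 0\<close> the minimiser is the point at which the tangent has direction \<open>v\<close>.
\<close>

definition P :: "complex \<Rightarrow> complex" where
  "P v = (SOME z. z \<in> range \<gamma> \<and> (\<forall>w \<in> range \<gamma>. cross v z \<le> cross v w))"

lemma P_minimises:
  "P v \<in> range \<gamma>" "w \<in> range \<gamma> \<Longrightarrow> cross v (P v) \<le> cross v w"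
proof -
  have "continuous_on (range \<gamma>) (cross v)" by (intro continuous_intros)
  hence "\<exists>z. z \<in> range \<gamma> \<and> (\<forall>w \<in> range \<gamma>. cross v z \<le> cross v w)"
    using continuous_attains_inf[OF compact_range, of "cross v"] by blast
  from someI_ex[OF this] have "P v \<in> range \<gamma> \<and> (\<forall>w \<in> range \<gamma>. cross v (P v) \<le> cross v w)"
    unfolding P_def .
  thus "P v \<in> range \<gamma>" "w \<in> range \<gamma> \<Longrightarrow> cross v (P v) \<le> cross v w" by blast+
qed

lemma P_tangent:
  assumes "v \<noteq> 0" obtains t r where "0 < r" "v = r *\<^sub>R velocity \<gamma> t" "P v = \<gamma> t"
proof -
  obtain t where t: "P v = \<gamma> t" using P_minimises(1) by blast
  have min: "cross v (\<gamma> t) \<le> cross v (\<gamma> s)" for s using P_minimises(2)[of "\<gamma> s" v] t by simp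
  have "cross (velocity \<gamma> t) v = 0"
    using cross_derivative_eq_0_of_min[OF has_velocity min] cross_swap[of v "velocity \<gamma> t"] by simp
  then obtain r where r: "v = r *\<^sub>R velocity \<gamma> t" using cross_eq_0_imp[OF velocity_nz] by blast
  have "\<gamma> (t + L / 2) \<noteq> \<gamma> t"
  proof
    assume "\<gamma> (t + L / 2) = \<gamma> t"
    then obtain n :: int where "t = t + L / 2 + of_int n * L" by (rule same_point)
    hence "L * (1 + 2 * of_int n) = 0" by (simp add: algebra_simps)
    hence "1 + 2 * real_of_int n = 0" using L_pos by simp
    hence "1 + 2 * n = 0" by linarith
    thus False by presburger
  qed
  hence "0 < cross (velocity \<gamma> t) (\<gamma> (t + L / 2) - \<gamma> t)" by (intro tangent_support curve_in_K)
  moreover have "0 \<le> cross v (\<gamma> (t + L / 2) - \<gamma> t)"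
    using min[of "t + L / 2"] by (simp add: cross_diff_right)
  hence "0 \<le> r * cross (velocity \<gamma> t) (\<gamma> (t + L / 2) - \<gamma> t)"
    by (simp add: r cross_scale_left)
  moreover have "r \<noteq> 0" using r assms by auto
  ultimately have "0 < r" by (simp add: zero_le_mult_iff)
  thus ?thesis using that r t by blast
qed

lemma P_support:
  assumes "v \<noteq> 0" "z \<in> K" "z \<noteq> P v" shows "0 < cross v (z - P v)"
proof -
  obtain t r where "0 < r" "v = r *\<^sub>R velocity \<gamma> t" "P v = \<gamma> t" using P_tangent[OF assms(1)] .
  thus ?thesis using tangent_support[of z t] assms by (simp add: cross_scale_left)
qed

lemma P_velocity: "P (velocity \<gamma> t) = \<gamma> t"
proof (rule ccontr)
  assume ne: "P (velocity \<gamma> t) \<noteq> \<gamma> t"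
  have "P (velocity \<gamma> t) \<in> K" using P_minimises(1) by (auto simp: K_def)
  from tangent_support[OF this ne] P_support[OF velocity_nz curve_in_K ne[symmetric]]
  show False by (simp add: cross_diff_right)
qed

text \<open>
  Continuity of \<open>P\<close> comes from its graph, which is closed, over the compact curve.
\<close>

sublocale oval P K
proof
  let ?S = "- {0} :: complex set" and ?T = "range \<gamma>"
  define C where "C = {p :: complex \<times> complex. \<forall>w \<in> ?T. cross (fst p) (snd p) \<le> cross (fst p) w}"
  have "C = (\<Inter>w \<in> ?T. {p. cross (fst p) (snd p) \<le> cross (fst p) w})" by (auto simp: C_def)
  also have "closed \<dots>" by (intro closed_INT ballI closed_Collect_le continuous_intros)
  finally have "closed C" .
  moreover have "(\<lambda>v. (v, P v)) ` ?S = (?S \<times> ?T) \<inter> C"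
  proof (intro equalityI subsetI)
    fix p assume "p \<in> (?S \<times> ?T) \<inter> C"
    obtain v z where "p = (v, z)" by (cases p)
    with \<open>p \<in> (?S \<times> ?T) \<inter> C\<close> have p: "p = (v, z)" "v \<noteq> 0" "z \<in> ?T"
      "\<forall>w \<in> ?T. cross v z \<le> cross v w" by (auto simp: C_def)
    have "z = P v"
    proof (rule ccontr)
      assume "z \<noteq> P v"
      hence "0 < cross v (z - P v)" using P_support p by (auto simp: K_def)
      thus False using bspec[OF p(4) P_minimises(1)[of v]] by (simp add: cross_diff_right)
    qed
    thus "p \<in> (\<lambda>v. (v, P v)) ` ?S" using p by auto
  qed (use P_minimises in \<open>auto simp: C_def\<close>)
  ultimately have "closedin (top_of_set (?S \<times> ?T)) ((\<lambda>v. (v, P v)) ` ?S)"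
    by (auto simp: closedin_closed)
  thus "continuous_on ?S P"
    using continuous_closed_graph_eq[OF compact_range, of P ?S] P_minimises(1) by blast
next
  fix v :: complex assume "v \<noteq> 0" thus "P v \<in> K" using P_minimises(1)[of v] by (auto simp: K_def)
next
  fix v z assume "v \<noteq> 0" "z \<in> K" "z \<noteq> P v" thus "0 < cross v (z - P v)" by (rule P_support)
next
  fix v w :: complex assume nz: "v \<noteq> 0" "w \<noteq> 0" and eq: "P v = P w"
  obtain t r where t: "0 < r" "v = r *\<^sub>R velocity \<gamma> t" "P v = \<gamma> t" using P_tangent[OF nz(1)] .
  obtain s q where s: "0 < q" "w = q *\<^sub>R velocity \<gamma> s" "P w = \<gamma> s" using P_tangent[OF nz(2)] .
  obtain n :: int where "s = t + of_int n * L" using same_point[of t s] eq t s by auto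
  hence "w = (q / r) *\<^sub>R v" using s t by (simp add: velocity_periodic_int)
  thus "\<exists>r>0. w = r *\<^sub>R v" using s t by (intro exI[of _ "q / r"]) auto
next
  fix x assume "x \<notin> K"
  then obtain a b where ab: "inner a x < b" "\<And>z. z \<in> K \<Longrightarrow> b < inner a z"
    using separating_hyperplane_closed_point[OF convex_K compact_imp_closed[OF compact_K]] by blast
  define v where "v = - \<i> * a"
  have iv: "\<i> * v = a" by (simp add: v_def)
  have "a \<noteq> 0" using ab(1) ab(2)[OF curve_in_K[of 0]] by auto
  hence "v \<noteq> 0" by (simp add: v_def)
  moreover have "P v \<in> K" using P_minimises(1) by (auto simp: K_def)
  ultimately show "\<exists>v. v \<noteq> 0 \<and> cross v (x - P v) < 0"
    using ab(1) ab(2)[of "P v"] by (intro exI[of _ v]) (simp add: cross_conv_inner iv inner_diff_right)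
qed

lemma range_P: "P ` (- {0}) = range \<gamma>"
proof
  show "range \<gamma> \<subseteq> P ` (- {0})"
  proof clarify
    fix t show "\<gamma> t \<in> P ` (- {0})"
      using P_velocity[of t] velocity_nz[of t] by (intro image_eqI[of _ _ "velocity \<gamma> t"]) auto
  qed
qed (use P_minimises(1) in auto)

lemma outer_billiard_pole:
  assumes "w \<noteq> 0" shows "outer_billiard \<gamma> (pole w) = pole (bounce w)"
proof -
  have "(\<exists>t \<mu>. 0 < \<mu> \<and> pole w = \<gamma> t - \<mu> *\<^sub>R velocity \<gamma> t \<and> y = \<gamma> t + \<mu> *\<^sub>R velocity \<gamma> t)
    \<longleftrightarrow> y = P w + w" for y
  proof
    assume "\<exists>t \<mu>. 0 < \<mu> \<and> pole w = \<gamma> t - \<mu> *\<^sub>R velocity \<gamma> t \<and> y = \<gamma> t + \<mu> *\<^sub>R velocity \<gamma> t"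
    then obtain t \<mu> where t: "0 < \<mu>" "pole w = \<gamma> t - \<mu> *\<^sub>R velocity \<gamma> t"
      "y = \<gamma> t + \<mu> *\<^sub>R velocity \<gamma> t" by blast
    let ?u = "\<mu> *\<^sub>R velocity \<gamma> t"
    have Pu: "P ?u = \<gamma> t" using P_scale[OF t(1) velocity_nz] P_velocity by simp
    hence "pole w = pole ?u" using t by (simp add: pole_def)
    hence "w = ?u" using inj_onD[OF inj_pole, of w ?u] assms t velocity_nz by simp
    thus "y = P w + w" using t Pu by simp
  next
    assume y: "y = P w + w"
    obtain t r where "0 < r" "w = r *\<^sub>R velocity \<gamma> t" "P w = \<gamma> t" using P_tangent[OF assms] .
    thus "\<exists>t \<mu>. 0 < \<mu> \<and> pole w = \<gamma> t - \<mu> *\<^sub>R velocity \<gamma> t \<and> y = \<gamma> t + \<mu> *\<^sub>R velocity \<gamma> t"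
      unfolding y pole_def by (intro exI[of _ t] exI[of _ r]) simp
  qed
  hence "outer_billiard \<gamma> (pole w) = P w + w" by (simp add: outer_billiard_def)
  thus ?thesis using pole_bounce[OF assms] by (simp add: pole_def)
qed

lemma outer_billiard_funpow_pole:
  assumes "w \<noteq> 0" shows "(outer_billiard \<gamma> ^^ i) (pole w) = pole ((bounce ^^ i) w) \<and> (bounce ^^ i) w \<noteq> 0"
  by (induction i) (auto simp: assms outer_billiard_pole)

end

section \<open>Lifting the invariant curve\<close>

lemma continuous_quasiperiodic_extension:
  fixes \<zeta> :: "real \<Rightarrow> complex"
  assumes cont: "continuous_on {0..1} \<zeta>" and end1: "\<zeta> 1 = \<zeta> 0 + turn n"
  obtains Y where "continuous_on UNIV Y" "\<forall>s. Y (s + 1) = Y s + turn n"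
    "\<And>s. exp (Y s) = exp (\<zeta> (frac s))"
proof
  define Y where "Y = (\<lambda>s. \<zeta> (frac s) + turn (\<lfloor>s\<rfloor> * n))"
  show "\<forall>s. Y (s + 1) = Y s + turn n"
    by (simp add: Y_def frac_1_eq distrib_right turn_add)
  show "exp (Y s) = exp (\<zeta> (frac s))" for s by (simp add: Y_def exp_add)
  have piece: "continuous_on {of_int m..of_int m + 1} Y" for m :: int
  proof -
    have Y_eq: "Y s = \<zeta> (s - of_int m) + turn (m * n)" if s: "s \<in> {of_int m..of_int m + 1}" for s
    \<comment> \<open>At the right end point the floor jumps, and \<open>end1\<close> makes the two formulas agree.\<close>
    proof (cases "s = of_int m + 1")
      case True thus ?thesis by (simp add: Y_def end1 frac_def distrib_right turn_add)
    next
      case False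
      hence "\<lfloor>s\<rfloor> = m" using s by (intro floor_unique) auto
      thus ?thesis by (simp add: Y_def frac_def)
    qed
    have "continuous_on {of_int m..of_int m + 1} (\<lambda>s. \<zeta> (s - of_int m) + turn (m * n))"
      by (intro continuous_intros continuous_on_compose2[OF cont]) auto
    thus ?thesis by (rule continuous_on_eq) (rule Y_eq[symmetric])
  qed
  show "continuous_on UNIV Y"
  proof (rule continuous_at_imp_continuous_on, rule ballI)
    fix s :: real
    define m where "m = \<lfloor>s\<rfloor>"
    have s: "of_int (m - 1) < s" "s < of_int m + 1" unfolding m_def by linarith+
    have "continuous_on ({of_int (m - 1)..of_int (m - 1) + 1} \<union> {of_int m..of_int m + 1}) Y"
      by (intro continuous_on_closed_Un piece) auto
    hence "continuous_on {of_int (m - 1)<..<of_int m + 1} Y"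
      by (rule continuous_on_subset) auto
    thus "isCont Y s" using s by (simp add: continuous_on_eq_continuous_at)
  qed
qed

context convex_curve
begin

text \<open>
  A logarithm of the curve gains a number \<open>n\<close> of full turns. If \<open>n\<close> were \<open>0\<close>, the logarithm would be a
  closed path in the plane, and contracting it there would contract the curve in the exterior.
  The number \<open>r\<close> does not depend on the point as it varies continuously; traversing the curve
  backwards if necessary makes \<open>n\<close> positive.
\<close>

lemma lift_of_periodic_curve:
  assumes c: "rotational_invariant_curve_of_periodic_orbits \<gamma> k c"
  obtains Z :: "real \<Rightarrow> complex" and n r where "continuous_on UNIV Z" "\<forall>s. Z (s + 1) = Z s + turn n" "0 < n"
    "\<forall>s. Z s \<in> periodic_lifts k r"
proof -
  have c_path: "path c" "pathfinish c = pathstart c" and c_ext: "path_image c \<subseteq> - K"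
    and c_ess: "\<And>a. \<not> homotopic_loops (- K) c (linepath a a)"
    and c_per: "\<And>x. x \<in> path_image c \<Longrightarrow> (outer_billiard \<gamma> ^^ k) x = x"
    using c unfolding rotational_invariant_curve_of_periodic_orbits_def
      rotational_invariant_curve_def minimal_period_def K_eq
    by (auto simp: simple_path_def)
  have c_in: "c s \<in> - K" "(outer_billiard \<gamma> ^^ k) (c s) = c s" if "s \<in> {0..1}" for s
  proof -
    have "c s \<in> path_image c" using that by (simp add: path_image_def)
    thus "c s \<in> - K" "(outer_billiard \<gamma> ^^ k) (c s) = c s" using c_ext c_per by blast+
  qed
  have "continuous_on {0..1} (\<lambda>s. unpole (c s))"
    using c_path(1) c_in(1) unfolding path_def
    by (intro continuous_on_compose2[OF continuous_unpole]) auto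
  moreover have "contractible {0..1::real}" by (rule convex_imp_contractible) simp
  moreover have "unpole (c s) \<noteq> 0" if "s \<in> {0..1}" for s using c_in(1)[OF that] by simp
  ultimately obtain \<zeta> where \<zeta>: "continuous_on {0..1} \<zeta>"
    and exp_\<zeta>: "\<And>s. s \<in> {0..1} \<Longrightarrow> unpole (c s) = exp (\<zeta> s)"
    using continuous_logarithm_on_contractible[of "{0..1}" "\<lambda>s. unpole (c s)"] by blast
  have pole_\<zeta>: "pole (exp (\<zeta> s)) = c s" if "s \<in> {0..1}" for s
    using exp_\<zeta>[OF that] c_in(1)[OF that] pole_unpole[of "c s"] by simp
  have "exp (\<zeta> 1 - \<zeta> 0) = 1"
    using exp_\<zeta>[of 0] exp_\<zeta>[of 1] c_path(2)
    by (simp add: exp_diff pathfinish_def pathstart_def)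
  then obtain n where n: "\<zeta> 1 - \<zeta> 0 = turn n" using exp_eq_1_turn by blast
  have "n \<noteq> 0"
  proof
    assume "n = 0"
    let ?h = "pole \<circ> exp"
    have "homotopic_loops UNIV \<zeta> (linepath 0 0)"
      using \<zeta> n \<open>n = 0\<close> by (intro homotopic_loops_linear) (auto simp: path_def pathfinish_def pathstart_def)
    moreover have "continuous_on UNIV ?h"
      unfolding comp_def by (rule continuous_on_compose2[OF continuous_pole]) (auto intro!: continuous_intros)
    moreover have "?h \<in> UNIV \<rightarrow> - K" using pole_notin by auto
    ultimately have "homotopic_loops (- K) (?h \<circ> \<zeta>) (?h \<circ> linepath 0 0)"
      by (rule homotopic_loops_continuous_image)
    moreover have "?h \<circ> linepath 0 0 = linepath (?h 0) (?h 0)"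
      by (simp add: fun_eq_iff linepath_def algebra_simps)
    moreover have "homotopic_loops (- K) c (?h \<circ> \<zeta>)"
      using c_path c_ext pole_\<zeta> by (intro homotopic_loops_eq) auto
    ultimately show False using c_ess homotopic_loops_trans by metis
  qed
  obtain Y where Y: "continuous_on UNIV Y" "\<forall>s. Y (s + 1) = Y s + turn n"
    and exp_Y: "\<And>s. exp (Y s) = exp (\<zeta> (frac s))"
    using continuous_quasiperiodic_extension[OF \<zeta>, of n] n by (auto simp: algebra_simps)
  have "exp ((lift ^^ k) (Y s) - Y s) = 1" for s
  proof -
    let ?w = "exp (\<zeta> (frac s))"
    have fr: "frac s \<in> {0..1}" by (simp add: frac_lt_1 less_imp_le)
    have "pole ((bounce ^^ k) ?w) = pole ?w"
      using outer_billiard_funpow_pole[of ?w k] c_in(2)[OF fr] pole_\<zeta>[OF fr] by simp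
    hence "(bounce ^^ k) ?w = ?w"
      using inj_onD[OF inj_pole, of "(bounce ^^ k) ?w" ?w] outer_billiard_funpow_pole[of ?w k] by simp
    thus ?thesis by (simp add: exp_diff exp_lift_funpow exp_Y)
  qed
  moreover have "continuous_on UNIV (\<lambda>s. (lift ^^ k) (Y s) - Y s)"
    by (intro continuous_intros continuous_on_compose2[OF continuous_lift_funpow Y(1)] Y(1)) auto
  ultimately obtain r where "\<And>s. (lift ^^ k) (Y s) - Y s = turn r"
    using exp_eq_1_constant[of UNIV "\<lambda>s. (lift ^^ k) (Y s) - Y s"] by auto
  hence per: "Y s \<in> periodic_lifts k r" for s by (simp add: periodic_lifts_def algebra_simps)
  show ?thesis
  proof (cases "0 < n")
    case True thus ?thesis using that Y per by blast
  next
    case False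
    have "Y (- (s + 1)) = Y (- s) + turn (- n)" for s
      using Y(2)[rule_format, of "- (s + 1)"] by (simp add: turn_minus algebra_simps)
    moreover have "continuous_on UNIV (\<lambda>s. Y (- s))"
      by (rule continuous_on_compose2[OF Y(1)]) (auto intro!: continuous_intros)
    ultimately show ?thesis
      using that[of "\<lambda>s. Y (- s)" "- n" r] False \<open>n \<noteq> 0\<close> per by simp
  qed
qed

end

section \<open>Ellipses as level sets\<close>

text \<open>
  In complex notation every symmetric bilinear form on the plane is \<open>a \<langle>x, y\<rangle> + Re (b x y)\<close>; it is
  positive definite if and only if \<open>\<bar>b\<bar> < a\<close>.
\<close>

lemma orbit_inner_form:
  fixes A :: "complex \<Rightarrow> complex"
  assumes lin: "linear A" and k: "0 < k"
  obtains a b where "\<And>x y. orbit_inner A k x y = a * inner x y + Re (b * x * y)" "cmod b < a"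
proof -
  have "\<exists>p. \<forall>z. (A ^^ j) z = fst p * z + snd p * cnj z" for j
    using linear_complex_form[OF funpow_linear[OF lin, of j]] by (metis fst_conv snd_conv)
  then obtain p where p: "\<And>j z. (A ^^ j) z = fst (p j) * z + snd (p j) * cnj z" by metis
  define a' where "a' = (\<lambda>j. (cmod (fst (p j)))\<^sup>2 + (cmod (snd (p j)))\<^sup>2)"
  define b' where "b' = (\<lambda>j. 2 * fst (p j) * cnj (snd (p j)))"
  define a where "a = (\<Sum>j<k. a' j)"
  define b where "b = (\<Sum>j<k. b' j)"
  have form: "orbit_inner A k x y = a * inner x y + Re (b * x * y)" for x y
  proof -
    have "inner ((A ^^ j) x) ((A ^^ j) y) = a' j * inner x y + Re (b' j * x * y)" for j
      unfolding p a'_def b'_def inner_complex_def cmod_power2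
      by (simp add: algebra_simps power2_eq_square)
    thus ?thesis
      by (simp only: orbit_inner_def a_def b_def sum.distrib sum_distrib_right Re_sum)
  qed
  have pos: "0 < orbit_inner A k z z" if "z \<noteq> 0" for z
  proof -
    have "inner ((A ^^ 0) z) ((A ^^ 0) z) \<le> orbit_inner A k z z"
      unfolding orbit_inner_def using k by (intro member_le_sum) auto
    moreover have "0 < inner ((A ^^ 0) z) ((A ^^ 0) z)" using that by simp
    ultimately show ?thesis by (rule less_le_trans[rotated])
  qed
  have "cmod b < a"
  proof (cases "b = 0")
    case True thus ?thesis using pos[of 1] form[of 1 1] by simp
  next
    case False
    \<comment> \<open>On this vector the form attains its least value \<open>(a - \<bar>b\<bar>) \<bar>z\<bar>\<^sup>2\<close>.\<close>
    define z where "z = csqrt (- cnj b)"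
    have zz: "z * z = - cnj b" by (simp add: z_def flip: power2_eq_square)
    hence "cmod z * cmod z = cmod b" by (metis complex_mod_cnj norm_minus_cancel norm_mult)
    hence inner: "inner z z = cmod b" by (simp add: dot_square_norm power2_eq_square)
    have "b * z * z = of_real (- (cmod b * cmod b))"
      by (simp add: mult.assoc zz complex_norm_square[symmetric] power2_eq_square flip: of_real_mult)
    moreover have "z \<noteq> 0" using zz False by auto
    ultimately have "0 < a * cmod b - cmod b * cmod b"
      using pos[of z] form[of z z] inner by simp
    hence "0 < (a - cmod b) * cmod b" by (simp add: left_diff_distrib)
    thus ?thesis using False zero_less_mult_pos2[of "a - cmod b" "cmod b"] by simp
  qed
  thus ?thesis using that form by blast
qed

text \<open>
  Rotating by half the argument of \<open>b\<close> diagonalises the form, with eigenvalues \<open>a \<plusminus> \<bar>b\<bar>\<close>.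
\<close>

lemma is_ellipse_quadratic_form:
  assumes ab: "cmod b < a" and c: "0 < c"
  shows "is_ellipse {z. a * inner z z + Re (b * z * z) = c}"
proof -
  define u where "u = cis (- Arg b / 2)"
  have u: "cmod u = 1" "u \<noteq> 0" by (simp_all add: u_def)
  have bu: "b * (u * u) = of_real (cmod b)"
  proof -
    have "u * u = cis (- Arg b)" by (simp add: u_def cis_mult)
    moreover have "b = rcis (cmod b) (Arg b)" by (simp add: rcis_cmod_Arg)
    ultimately have "b * (u * u) = rcis (cmod b) (Arg b) * cis (- Arg b)" by simp
    thus ?thesis by (simp add: rcis_def cis_mult mult.assoc)
  qed
  define p where "p = sqrt (c / (a + cmod b))"
  define q where "q = sqrt (c / (a - cmod b))"
  have pos: "0 < a + cmod b" "0 < a - cmod b" using ab norm_ge_zero[of b] by linarith+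
  have pq: "0 < p" "0 < q" "p\<^sup>2 = c / (a + cmod b)" "q\<^sup>2 = c / (a - cmod b)"
    using pos c by (simp_all add: p_def q_def)
  have Q: "a * inner (u * w) (u * w) + Re (b * (u * w) * (u * w)) = c
      \<longleftrightarrow> (Re w / p)\<^sup>2 + (Im w / q)\<^sup>2 = 1" for w
  proof -
    have 1: "inner (u * w) (u * w) = (Re w)\<^sup>2 + (Im w)\<^sup>2"
      by (simp add: dot_square_norm norm_mult u cmod_power2)
    have "b * (u * w) * (u * w) = b * (u * u) * (w * w)" by (simp add: algebra_simps)
    also have "Re \<dots> = cmod b * ((Re w)\<^sup>2 - (Im w)\<^sup>2)"
      unfolding bu by (simp add: power2_eq_square)
    finally have "a * inner (u * w) (u * w) + Re (b * (u * w) * (u * w))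
      = (a + cmod b) * (Re w)\<^sup>2 + (a - cmod b) * (Im w)\<^sup>2"
      unfolding 1 by (simp add: algebra_simps)
    also have "\<dots> = c * ((Re w / p)\<^sup>2 + (Im w / q)\<^sup>2)"
      using c by (simp add: power_divide pq field_simps)
    finally show ?thesis using c by simp
  qed
  have "{z. a * inner z z + Re (b * z * z) = c} = (\<lambda>w. 0 + u * w) ` {w. (Re w / p)\<^sup>2 + (Im w / q)\<^sup>2 = 1}"
  proof (intro equalityI subsetI)
    fix z assume z: "z \<in> {z. a * inner z z + Re (b * z * z) = c}"
    have "z = u * (z / u)" using u by simp
    thus "z \<in> (\<lambda>w. 0 + u * w) ` {w. (Re w / p)\<^sup>2 + (Im w / q)\<^sup>2 = 1}"
      using z Q[of "z / u"] by (intro image_eqI[of _ _ "z / u"]) auto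
  qed (use Q in auto)
  thus ?thesis unfolding is_ellipse_def using u pq by blast
qed

context convex_curve
begin

text \<open>
  The hypothesis says that the derivative of the quadratic form along the curve vanishes, so the
  curve lies on a level set. Conversely let \<open>z\<close> be on this level set, and \<open>v\<close> a direction conjugate to \<open>z\<close>.
  The curve has two different points with tangent directions \<open>v\<close> and \<open>-v\<close>. Each is conjugate to \<open>v\<close> and so
  equals \<open>z\<close> or \<open>-z\<close>; hence one of them is \<open>z\<close>.
\<close>

lemma is_ellipse_if_tangents_conjugate:
  assumes ab: "cmod b < a"
    and conj: "\<And>v. v \<noteq> 0 \<Longrightarrow> a * inner (P v) v + Re (b * P v * v) = 0"
  shows "is_ellipse (range \<gamma>)"
proof -
  define Q where "Q = (\<lambda>z. a * inner z z + Re (b * z * z))"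
  have Q_pos: "0 < Q z" if "z \<noteq> 0" for z
  proof -
    have "- Re (b * z * z) \<le> cmod (b * z * z)" using abs_Re_le_cmod[of "b * z * z"] by linarith
    also have "\<dots> = cmod b * inner z z" by (simp add: norm_mult dot_square_norm power2_eq_square)
    also have "\<dots> < a * inner z z" using ab that by simp
    finally show ?thesis by (simp add: Q_def)
  qed
  have "((\<lambda>t. Q (\<gamma> t)) has_real_derivative 0) (at t)" for t
  proof -
    have x: "((\<lambda>t. Re (\<gamma> t)) has_real_derivative Re (velocity \<gamma> t)) (at t)"
      and y: "((\<lambda>t. Im (\<gamma> t)) has_real_derivative Im (velocity \<gamma> t)) (at t)"
      unfolding has_real_derivative_iff_has_vector_derivative
      by (rule bounded_linear.has_vector_derivative[OF bounded_linear_Re has_velocity]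
               bounded_linear.has_vector_derivative[OF bounded_linear_Im has_velocity])+
    have Q_eq: "Q z = (a + Re b) * (Re z * Re z) + (a - Re b) * (Im z * Im z) - 2 * Im b * (Re z * Im z)" for z
      by (simp add: Q_def inner_complex_def algebra_simps)
    have zero: "a * inner (\<gamma> t) (velocity \<gamma> t) + Re (b * \<gamma> t * velocity \<gamma> t) = 0"
      using conj[OF velocity_nz[of t]] unfolding P_velocity .
    have "((\<lambda>t. Q (\<gamma> t)) has_real_derivative
        2 * (a * inner (\<gamma> t) (velocity \<gamma> t) + Re (b * \<gamma> t * velocity \<gamma> t))) (at t)"
      unfolding Q_eq
      by (rule derivative_eq_intros x y refl)+ (simp add: inner_complex_def algebra_simps)
    thus ?thesis unfolding zero by simp
  qed
  hence const: "Q (\<gamma> s) = Q (\<gamma> t)" for s t using DERIV_isconst_all by blast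
  define c where "c = Q (\<gamma> 0)"
  have Q_c: "Q z = c" if "z \<in> range \<gamma>" for z using that const unfolding c_def by blast
  have "\<exists>t. \<gamma> t \<noteq> 0"
  proof (rule ccontr)
    assume "\<not> ?thesis"
    hence "\<gamma> (L / 2) = \<gamma> 0" by metis
    hence "L / 2 = 0" using L_pos by (intro inj_onD[OF inj]) auto
    thus False using L_pos by simp
  qed
  then obtain t where "\<gamma> t \<noteq> 0" by blast
  hence c: "0 < c" using Q_pos[of "\<gamma> t"] Q_c[of "\<gamma> t"] by simp
  have "z \<in> range \<gamma>" if z: "Q z = c" for z
  proof -
    have z_nz: "z \<noteq> 0" using z c by (auto simp: Q_def)
    have nondeg: "of_real a * cnj x + b * x \<noteq> 0" if "x \<noteq> 0" for x
    proof
      assume "of_real a * cnj x + b * x = 0"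
      hence "cmod (of_real a * cnj x) = cmod (b * x)" by (metis add_eq_0_iff norm_minus_cancel)
      hence "\<bar>a\<bar> * cmod x = cmod b * cmod x" by (simp add: norm_mult)
      thus False using ab that by auto
    qed
    have form: "a * inner x y + Re (b * x * y) = Re ((of_real a * cnj y + b * y) * x)" for x y
      by (simp add: inner_complex_def algebra_simps)
    have form': "a * inner x y + Re (b * x * y) = Re ((of_real a * cnj x + b * x) * y)" for x y
      by (simp add: inner_complex_def algebra_simps)
    define v where "v = \<i> * cnj (of_real a * cnj z + b * z)"
    have v: "v \<noteq> 0"
      using nondeg[OF z_nz] by (simp only: v_def mult_eq_0_iff complex_cnj_zero_iff) simp
    have zv: "a * inner z v + Re (b * z * v) = 0"
      unfolding form' by (simp add: v_def algebra_simps)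
    have sign: "P w = z \<or> P w = - z" if w: "w \<noteq> 0" "a * inner z w + Re (b * z * w) = 0" for w
    proof -
      define m where "m = of_real a * cnj w + b * w"
      have "Re (m * z) = 0" "Re (m * P w) = 0"
        using w conj[OF w(1)] unfolding form m_def by simp_all
      hence "cross (m * z) (m * P w) = 0" by (simp add: cross_def)
      moreover have "cross (m * z) (m * P w) = (cmod m)\<^sup>2 * cross z (P w)"
        unfolding cross_def cmod_power2 by (simp add: power2_eq_square algebra_simps)
      ultimately have "cross z (P w) = 0" using nondeg[OF w(1)] by (simp add: m_def)
      then obtain r where r: "P w = r *\<^sub>R z" using cross_eq_0_imp[OF z_nz] by blast
      have "Q (P w) = c" by (rule Q_c[OF P_minimises(1)])
      moreover have "Q (r *\<^sub>R z) = r\<^sup>2 * Q z"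
        by (simp add: Q_def power2_eq_square algebra_simps)
      ultimately have "r\<^sup>2 * c = c" by (simp add: r z)
      hence "r\<^sup>2 = 1" using c by simp
      hence "r = 1 \<or> r = -1" by (simp add: power2_eq_1_iff)
      thus ?thesis using r by auto
    qed
    have "P v \<noteq> P (- v)"
    proof
      assume "P v = P (- v)"
      then obtain r where r: "r > 0" "- v = r *\<^sub>R v" using smooth[of v "- v"] v by auto
      hence "(1 + r) *\<^sub>R v = 0" by (simp add: scaleR_add_left flip: r(2))
      thus False using v r(1) by simp
    qed
    moreover have "a * inner z (- v) + Re (b * z * (- v)) = 0" using zv by simp
    ultimately have "P v = z \<or> P (- v) = z" using sign[OF v zv] sign[of "- v"] v by auto
    thus "z \<in> range \<gamma>" using P_minimises(1) by metis
  qed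
  hence "range \<gamma> = {z. a * inner z z + Re (b * z * z) = c}" using Q_c unfolding Q_def by blast
  thus ?thesis using is_ellipse_quadratic_form[OF ab c] by simp
qed

end

theorem theorem2:
  fixes k :: nat and L :: real and \<gamma> :: "real \<Rightarrow> complex" and A :: "complex \<Rightarrow> complex"
  assumes "3 \<le> k"
    and "regular_closed_curve L \<gamma>"
    and "C2_smooth \<gamma>"
    and "positively_oriented L \<gamma>"
    and "strictly_convex_curve \<gamma>"
    and "linear A"
    and "map_order A k"
    and "A ` range \<gamma> = range \<gamma>"
    and "\<exists>c. rotational_invariant_curve_of_periodic_orbits \<gamma> k c"
  shows "is_ellipse (range \<gamma>)"
proof -
  interpret convex_curve L \<gamma>
    by unfold_locales (use assms in \<open>auto simp: C2_smooth_def\<close>)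
  obtain \<alpha> \<beta> where form: "\<And>z. A z = \<alpha> * z + \<beta> * cnj z"
    using linear_complex_form[OF \<open>linear A\<close>] by blast
  interpret symmetric_oval P K A k \<alpha> \<beta>
  proof
    show "cmod \<beta> < cmod \<alpha>"
      using det_pos_of_order_ge_3[OF \<open>linear A\<close> form \<open>map_order A k\<close> \<open>3 \<le> k\<close>] .
    show "A ` P ` (- {0}) = P ` (- {0})" unfolding range_P by fact
  qed (use form assms in auto)
  obtain c where "rotational_invariant_curve_of_periodic_orbits \<gamma> k c" using assms(9) by blast
  then obtain Z :: "real \<Rightarrow> complex" and n r where Z: "continuous_on UNIV Z" "\<forall>s. Z (s + 1) = Z s + turn n" "0 < n"
    "\<forall>s. Z s \<in> periodic_lifts k r"
    by (rule lift_of_periodic_curve)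
  obtain a b where ab: "\<And>x y. orbit_inner A k x y = a * inner x y + Re (b * x * y)" "cmod b < a"
    using orbit_inner_form[OF linear_A k_pos] by blast
  have "2 \<le> k" using \<open>3 \<le> k\<close> by simp
  have "a * inner (P v) v + Re (b * P v * v) = 0" if "v \<noteq> 0" for v
    using tangent_conjugate_to_position[OF \<open>2 \<le> k\<close> Z that] unfolding ab(1) .
  thus ?thesis by (rule is_ellipse_if_tangents_conjugate[OF ab(2)])
qed

end
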